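(* Let $p(z_1,z_2)=a_{10}z_1+a_{01}z_2+a_{20}z_1^2+a_{11}z_1z_2+a_{02}z_2^2$ be a complex polynomial, and set $p_1(z)=a_{10}+a_{01}z$ and $p_2(z)=a_{20}+a_{11}z+a_{02}z^2$. There exists a holomorphic function $q$ on the bidisc $\mathbb{D}^2$ with $q^{(k)}(0)=0$ for all multi-indices $|k|\le 2$ such that $\|p+q\|_{\mathbb{D}^2,\infty}\le 1$ if and only if $|p_2(z)|\le 1-|p_1(z)|^2$ for all $z\in\mathbb{T}$ and there exists a holomorphic function $f:\mathbb{D}\to\mathcal{B}(L^2(\mathbb{T}))$ with \[\sup_{z\in\mathbb{D}}\|f(z)\|_{op}\le 1\quad\text{and}\quad\frac{f^{(k)}(0)}{k!}=M_{p_k}\ \text{ for all }k\ge 0,\] where $p_0=0$, $p_1,p_2$ are as given, and for each $k\ge 3$, $p_k\in\mathbb{C}[Z]$ is some polynomial of degree at most $k$.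
   Context: $\mathbb{D}$ is the open unit disc, $\mathbb{T}$ the unit circle; $\|g\|_{\mathbb{D}^2,\infty}=\sup_{\mathbb{D}^2}|g|$. $M_{p_k}$ is the operator of multiplication by $p_k$ on $L^2(\mathbb{T})$. $q^{(k)}$ is the partial derivative of multi-index $k$. *)

theory Defs
  imports "HOL-Analysis.Analysis" "HOL-Computational_Algebra.Polynomial"
begin

section \<open>The Hilbert space of square-integrable functions on the unit circle\<close>

text \<open>Normalised arc length on the unit circle.\<close>

definition circle_measure :: "complex measure" where
  "circle_measure =
     distr (uniform_measure lborel {0..2 * pi}) (restrict_space borel (sphere 0 1)) cis"

lemma space_circle_measure [simp]: "space circle_measure = sphere 0 1"
  by (simp add: circle_measure_def space_restrict_space)

lemma sets_circle_measure [measurable_cong]: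
  "sets circle_measure = sets (restrict_space borel (sphere 0 1))"
  by (simp add: circle_measure_def)

definition square_integrable :: "(complex \<Rightarrow> complex) \<Rightarrow> bool" where
  "square_integrable g \<longleftrightarrow>
     g \<in> borel_measurable circle_measure \<and> integrable circle_measure (\<lambda>z. (cmod (g z))\<^sup>2)"

lemma square_integrable_measurable:
  "square_integrable g \<Longrightarrow> g \<in> borel_measurable circle_measure"
  by (simp add: square_integrable_def)

lemma square_integrable_zero: "square_integrable (\<lambda>z. 0)"
  by (simp add: square_integrable_def)

lemma square_integrable_mult_bounded:
  assumes "square_integrable g" and [measurable]: "m \<in> borel_measurable circle_measure"
    and B: "\<And>z. z \<in> sphere 0 1 \<Longrightarrow> cmod (m z) \<le> B"
  shows "square_integrable (\<lambda>z. m z * g z)"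
proof -
  have [measurable]: "g \<in> borel_measurable circle_measure"
    and i: "integrable circle_measure (\<lambda>z. (cmod (g z))\<^sup>2)"
    using assms(1) by (auto simp: square_integrable_def)
  have "integrable circle_measure (\<lambda>z. (cmod (m z * g z))\<^sup>2)"
  proof (rule Bochner_Integration.integrable_bound[where f = "\<lambda>z. B\<^sup>2 * (cmod (g z))\<^sup>2"])
    show "AE z in circle_measure. norm ((cmod (m z * g z))\<^sup>2) \<le> norm (B\<^sup>2 * (cmod (g z))\<^sup>2)"
      using B by (intro AE_I2) (auto simp: norm_mult power_mult_distrib intro!: mult_right_mono power_mono)
  qed (use i in auto)
  then show ?thesis by (simp add: square_integrable_def)
qed

lemma square_integrable_cmult:
  "square_integrable g \<Longrightarrow> square_integrable (\<lambda>z. c * g z)"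
  by (rule square_integrable_mult_bounded[where B = "cmod c"]) auto

lemma square_integrable_scaleR:
  "square_integrable g \<Longrightarrow> square_integrable (\<lambda>z. r *\<^sub>R g z)"
  using square_integrable_cmult[of g "of_real r"] by (simp add: scaleR_conv_of_real)

lemma square_integrable_uminus:
  "square_integrable g \<Longrightarrow> square_integrable (\<lambda>z. - g z)"
  using square_integrable_cmult[of g "- 1"] by simp

lemma square_integrable_add:
  assumes "square_integrable g" "square_integrable h"
  shows "square_integrable (\<lambda>z. g z + h z)"
proof -
  have [measurable]: "g \<in> borel_measurable circle_measure" "h \<in> borel_measurable circle_measure"
    and i: "integrable circle_measure (\<lambda>z. (cmod (g z))\<^sup>2)"
      "integrable circle_measure (\<lambda>z. (cmod (h z))\<^sup>2)"
    using assms by (auto simp: square_integrable_def)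
  have b: "(cmod (a + b))\<^sup>2 \<le> 2 * (cmod a)\<^sup>2 + 2 * (cmod b)\<^sup>2" for a b
  proof -
    have "(cmod (a + b))\<^sup>2 \<le> (cmod a + cmod b)\<^sup>2"
      by (intro power_mono norm_triangle_ineq) auto
    also have "\<dots> \<le> 2 * (cmod a)\<^sup>2 + 2 * (cmod b)\<^sup>2"
      using sum_squares_bound[of "cmod a" "cmod b"] by (simp add: power2_sum)
    finally show ?thesis .
  qed
  have "integrable circle_measure (\<lambda>z. (cmod (g z + h z))\<^sup>2)"
    by (rule Bochner_Integration.integrable_bound
        [where f = "\<lambda>z. 2 * (cmod (g z))\<^sup>2 + 2 * (cmod (h z))\<^sup>2"]) (use i b in auto)
  then show ?thesis by (simp add: square_integrable_def)
qed

lemma square_integrable_diff: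
  "square_integrable g \<Longrightarrow> square_integrable h \<Longrightarrow> square_integrable (\<lambda>z. g z - h z)"
  using square_integrable_add[OF _ square_integrable_uminus, of g h] by simp

lemma integrable_inner_square_integrable:
  assumes "square_integrable g" "square_integrable h"
  shows "integrable circle_measure (\<lambda>z. inner (g z) (h z))"
proof -
  have [measurable]: "g \<in> borel_measurable circle_measure" "h \<in> borel_measurable circle_measure"
    and i: "integrable circle_measure (\<lambda>z. (cmod (g z))\<^sup>2)"
      "integrable circle_measure (\<lambda>z. (cmod (h z))\<^sup>2)"
    using assms by (auto simp: square_integrable_def)
  have b: "\<bar>inner a b\<bar> \<le> (cmod a)\<^sup>2 + (cmod b)\<^sup>2" for a b :: complex
  proof -
    have "\<bar>inner a b\<bar> \<le> cmod a * cmod b" by (rule Cauchy_Schwarz_ineq2)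
    moreover have "0 \<le> cmod a * cmod b" by simp
    ultimately show ?thesis using sum_squares_bound[of "cmod a" "cmod b"] by linarith
  qed
  show ?thesis
    by (rule Bochner_Integration.integrable_bound
        [where f = "\<lambda>z. (cmod (g z))\<^sup>2 + (cmod (h z))\<^sup>2"]) (use i b in auto)
qed

definition l2_rel :: "(complex \<Rightarrow> complex) \<Rightarrow> (complex \<Rightarrow> complex) \<Rightarrow> bool" where
  "l2_rel g h \<longleftrightarrow>
     square_integrable g \<and> square_integrable h \<and> (AE z in circle_measure. g z = h z)"

quotient_type l2 = "complex \<Rightarrow> complex" / partial: l2_rel
proof (rule part_equivpI)
  show "\<exists>g. l2_rel g g"
    using square_integrable_zero by (auto simp: l2_rel_def)
  show "symp l2_rel"
    by (rule sympI) (auto simp: l2_rel_def elim: AE_mp)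
  show "transp l2_rel"
    by (rule transpI) (auto simp: l2_rel_def elim: AE_mp)
qed

text \<open>The inner product below is the real part of the Hermitian inner product of
  the complex Hilbert space, and it induces the same norm. Since the library has no
  class of complex normed spaces, scalar multiplication by complex numbers is the
  separate function \<open>scaleC\<close>.\<close>

instantiation l2 :: real_inner
begin

lift_definition zero_l2 :: l2 is "\<lambda>z. 0"
  by (simp add: l2_rel_def square_integrable_zero)

lift_definition plus_l2 :: "l2 \<Rightarrow> l2 \<Rightarrow> l2" is "\<lambda>g h z. g z + h z"
  by (auto simp: l2_rel_def intro: square_integrable_add)

lift_definition minus_l2 :: "l2 \<Rightarrow> l2 \<Rightarrow> l2" is "\<lambda>g h z. g z - h z"
  by (auto simp: l2_rel_def intro: square_integrable_diff)

lift_definition uminus_l2 :: "l2 \<Rightarrow> l2" is "\<lambda>g z. - g z"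
  by (auto simp: l2_rel_def intro: square_integrable_uminus)

lift_definition scaleR_l2 :: "real \<Rightarrow> l2 \<Rightarrow> l2" is "\<lambda>r g z. r *\<^sub>R g z"
  by (auto simp: l2_rel_def intro: square_integrable_scaleR)

lift_definition norm_l2 :: "l2 \<Rightarrow> real"
  is "\<lambda>g. sqrt (\<integral>z. (cmod (g z))\<^sup>2 \<partial>circle_measure)"
  by (auto simp: l2_rel_def square_integrable_def intro!: integral_cong_AE)

lift_definition inner_l2 :: "l2 \<Rightarrow> l2 \<Rightarrow> real"
  is "\<lambda>g h. \<integral>z. Re (g z * cnj (h z)) \<partial>circle_measure"
  by (auto simp: l2_rel_def square_integrable_def intro!: integral_cong_AE)

definition sgn_l2 :: "l2 \<Rightarrow> l2" where "sgn_l2 x = scaleR (inverse (norm x)) x"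

definition dist_l2 :: "l2 \<Rightarrow> l2 \<Rightarrow> real" where "dist_l2 x y = norm (x - y)"

definition uniformity_l2 :: "(l2 \<times> l2) filter" where
  "uniformity_l2 = (INF e\<in>{0 <..}. principal {(x, y). dist x y < e})"

definition open_l2 :: "l2 set \<Rightarrow> bool" where
  "open_l2 U = (\<forall>x\<in>U. eventually (\<lambda>(x', y). x' = x \<longrightarrow> y \<in> U) uniformity)"

lemma Re_mult_cnj_eq_inner: "Re (a * cnj b) = inner a b"
  by (simp add: inner_complex_def)

instance
proof
  fix x y z :: l2 and a b r :: real and U :: "l2 set"
  show "x + y + z = x + (y + z)"
    by transfer (auto simp: l2_rel_def algebra_simps intro!: square_integrable_add)
  show "x + y = y + x"
    by transfer (auto simp: l2_rel_def algebra_simps intro!: square_integrable_add)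
  show "0 + x = x"
    by transfer (auto simp: l2_rel_def)
  show "- x + x = 0"
    by transfer (auto simp: l2_rel_def square_integrable_zero)
  show "x - y = x + - y"
    by transfer (auto simp: l2_rel_def intro!: square_integrable_diff)
  show "a *\<^sub>R (x + y) = a *\<^sub>R x + a *\<^sub>R y"
    by transfer
      (auto simp: l2_rel_def scaleR_add_right intro!: square_integrable_add square_integrable_scaleR)
  show "(a + b) *\<^sub>R x = a *\<^sub>R x + b *\<^sub>R x"
    by transfer
      (auto simp: l2_rel_def scaleR_add_left intro!: square_integrable_add square_integrable_scaleR)
  show "a *\<^sub>R b *\<^sub>R x = (a * b) *\<^sub>R x"
    using square_integrable_scaleR[of _ "a * b"] by transfer (auto simp: l2_rel_def)
  show "1 *\<^sub>R x = x"
    by transfer (auto simp: l2_rel_def)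
  show "sgn x = inverse (norm x) *\<^sub>R x"
    by (simp add: sgn_l2_def)
  show "dist x y = norm (x - y)"
    by (rule dist_l2_def)
  show "(uniformity :: (l2 \<times> l2) filter) = (INF e\<in>{0 <..}. principal {(x, y). dist x y < e})"
    by (rule uniformity_l2_def)
  show "open U = (\<forall>x\<in>U. eventually (\<lambda>(x', y). x' = x \<longrightarrow> y \<in> U) uniformity)"
    by (rule open_l2_def)
  show "inner x y = inner y x"
    by transfer (simp only: Re_mult_cnj_eq_inner inner_commute)
  show "inner (x + y) z = inner x z + inner y z"
    by transfer (simp only: Re_mult_cnj_eq_inner inner_add_left l2_rel_def
        integrable_inner_square_integrable Bochner_Integration.integral_add)
  show "inner (r *\<^sub>R x) y = r * inner x y"
    by transfer (simp only: Re_mult_cnj_eq_inner inner_scaleR_left integral_mult_right_zero)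
  show "0 \<le> inner x x"
    by transfer (simp add: Re_mult_cnj_eq_inner)
  show "(inner x x = 0) = (x = 0)"
  proof transfer
    fix g assume g: "l2_rel g g"
    then have "integrable circle_measure (\<lambda>z. inner (g z) (g z))"
      by (simp add: l2_rel_def integrable_inner_square_integrable)
    then have "(\<integral>z. inner (g z) (g z) \<partial>circle_measure) = 0 \<longleftrightarrow>
        (AE z in circle_measure. inner (g z) (g z) = 0)"
      by (rule integral_nonneg_eq_0_iff_AE) simp
    then show "((\<integral>z. Re (g z * cnj (g z)) \<partial>circle_measure) = 0) = l2_rel g (\<lambda>z. 0)"
      unfolding Re_mult_cnj_eq_inner using g square_integrable_zero by (simp add: l2_rel_def)
  qed
  show "norm x = sqrt (inner x x)"
    by transfer (simp only: Re_mult_cnj_eq_inner power2_norm_eq_inner)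
qed

end

lift_definition scaleC :: "complex \<Rightarrow> l2 \<Rightarrow> l2" is "\<lambda>c g z. c * g z"
  by (auto simp: l2_rel_def intro: square_integrable_cmult)

lemma borel_measurable_poly_circle [measurable]:
  "poly p \<in> borel_measurable circle_measure" for p :: "complex poly"
proof -
  have "poly p \<in> borel_measurable borel"
    by (intro borel_measurable_continuous_onI continuous_intros)
  then show ?thesis
    unfolding measurable_cong_sets[OF sets_circle_measure refl] by (rule measurable_restrict_space1)
qed

lemma poly_bounded_circle:
  fixes p :: "complex poly"
  obtains B where "B \<ge> 0" "\<And>z. z \<in> sphere 0 1 \<Longrightarrow> cmod (poly p z) \<le> B"
proof -
  have "compact (poly p ` sphere 0 1)"
    by (intro compact_continuous_image continuous_intros compact_sphere)
  then have "bounded (poly p ` sphere 0 1)"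
    by (rule compact_imp_bounded)
  then obtain B where "B > 0" "\<forall>w\<in>poly p ` sphere 0 1. cmod w \<le> B"
    unfolding bounded_pos by blast
  then show thesis by (intro that[of B]) simp_all
qed

lemma square_integrable_mult_poly:
  fixes p :: "complex poly"
  assumes "square_integrable g"
  shows "square_integrable (\<lambda>z. poly p z * g z)"
proof -
  obtain B where B: "B \<ge> 0" "\<And>z. z \<in> sphere 0 1 \<Longrightarrow> cmod (poly p z) \<le> B"
    using poly_bounded_circle[of p] by metis
  show ?thesis
    by (rule square_integrable_mult_bounded[OF assms borel_measurable_poly_circle B(2)])
qed

lift_definition mult_poly :: "complex poly \<Rightarrow> l2 \<Rightarrow> l2" is "\<lambda>p g z. poly p z * g z"
  by (auto simp: l2_rel_def intro: square_integrable_mult_poly)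

lemma norm_mult_poly_le:
  assumes "B \<ge> 0" "\<And>z. z \<in> sphere 0 1 \<Longrightarrow> cmod (poly p z) \<le> B"
  shows "norm (mult_poly p x) \<le> B * norm x"
  using assms
proof (transfer fixing: B p)
  fix g assume g: "l2_rel g g" and B: "B \<ge> 0" "\<And>z. z \<in> sphere 0 1 \<Longrightarrow> cmod (poly p z) \<le> B"
  then have sq: "square_integrable g" by (simp add: l2_rel_def)
  have "(\<integral>z. (cmod (poly p z * g z))\<^sup>2 \<partial>circle_measure)
      \<le> (\<integral>z. B\<^sup>2 * (cmod (g z))\<^sup>2 \<partial>circle_measure)"
  proof (rule integral_mono)
    show "integrable circle_measure (\<lambda>z. (cmod (poly p z * g z))\<^sup>2)"
      using square_integrable_mult_poly[OF sq]
      by (simp add: square_integrable_def)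
    show "integrable circle_measure (\<lambda>z. B\<^sup>2 * (cmod (g z))\<^sup>2)"
      using sq by (simp add: square_integrable_def)
    show "(cmod (poly p z * g z))\<^sup>2 \<le> B\<^sup>2 * (cmod (g z))\<^sup>2" if "z \<in> space circle_measure" for z
      using B(2)[of z] that
      by (simp add: norm_mult power_mult_distrib mult_right_mono power_mono del: mem_sphere)
  qed
  then have "sqrt (\<integral>z. (cmod (poly p z * g z))\<^sup>2 \<partial>circle_measure)
      \<le> sqrt (B\<^sup>2 * (\<integral>z. (cmod (g z))\<^sup>2 \<partial>circle_measure))"
    by (rule real_sqrt_le_mono[OF ord_le_eq_trans]) (rule integral_mult_right_zero)
  also have "\<dots> = B * sqrt (\<integral>z. (cmod (g z))\<^sup>2 \<partial>circle_measure)"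
    using B(1) by (simp only: real_sqrt_mult real_sqrt_abs abs_of_nonneg)
  finally show "sqrt (\<integral>z. (cmod (poly p z * g z))\<^sup>2 \<partial>circle_measure)
      \<le> B * sqrt (\<integral>z. (cmod (g z))\<^sup>2 \<partial>circle_measure)" .
qed

lemma bounded_linear_mult_poly: "bounded_linear (mult_poly p)"
proof -
  obtain B where B: "B \<ge> 0" "\<And>z. z \<in> sphere 0 1 \<Longrightarrow> cmod (poly p z) \<le> B"
    using poly_bounded_circle[of p] by metis
  show ?thesis
  proof (rule bounded_linear_intro[where K = B])
    show "mult_poly p (x + y) = mult_poly p x + mult_poly p y" for x y
      by transfer (auto simp: l2_rel_def distrib_left intro!: square_integrable_add square_integrable_mult_poly)
    show "mult_poly p (r *\<^sub>R x) = r *\<^sub>R mult_poly p x" for r x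
      by transfer (auto simp: l2_rel_def intro!: square_integrable_scaleR square_integrable_mult_poly)
    show "norm (mult_poly p x) \<le> norm x * B" for x
      using norm_mult_poly_le[OF B, of x] by (simp add: mult.commute)
  qed
qed

lemma scaleC_eq_mult_poly: "scaleC c = mult_poly [:c:]"
  by (rule ext, transfer) (auto simp: l2_rel_def intro!: square_integrable_cmult)

lemma bounded_linear_scaleC: "bounded_linear (scaleC c)"
  by (simp add: scaleC_eq_mult_poly bounded_linear_mult_poly)


section \<open>Bounded operators and operator-valued holomorphic functions\<close>

text \<open>The type \<open>l2 \<Rightarrow>\<^sub>L l2\<close>, normed by the operator norm, consists of the real-linear
  bounded operators; \<open>bounded_ops\<close> is the space of the complex-linear ones.\<close>

definition bounded_ops :: "(l2 \<Rightarrow>\<^sub>L l2) set" where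
  "bounded_ops = {T. \<forall>c x. blinfun_apply T (scaleC c x) = scaleC c (blinfun_apply T x)}"

definition mult_op :: "complex poly \<Rightarrow> l2 \<Rightarrow>\<^sub>L l2" where
  "mult_op p = Blinfun (mult_poly p)"

lemma blinfun_apply_mult_op [simp]: "blinfun_apply (mult_op p) = mult_poly p"
  by (simp add: mult_op_def bounded_linear_Blinfun_apply bounded_linear_mult_poly)

definition scaleC_op :: "complex \<Rightarrow> (l2 \<Rightarrow>\<^sub>L l2) \<Rightarrow> (l2 \<Rightarrow>\<^sub>L l2)" where
  "scaleC_op c T = Blinfun (\<lambda>x. scaleC c (blinfun_apply T x))"

lemma blinfun_apply_scaleC_op [simp]:
  "blinfun_apply (scaleC_op c T) x = scaleC c (blinfun_apply T x)"
  by (simp add: scaleC_op_def bounded_linear_Blinfun_apply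
      bounded_linear_compose[OF bounded_linear_scaleC] blinfun.bounded_linear_right)

lemma mult_op_in_bounded_ops: "mult_op p \<in> bounded_ops"
proof -
  have "mult_poly p (scaleC c x) = scaleC c (mult_poly p x)" for c x
    by transfer (auto simp: l2_rel_def mult.left_commute
        intro!: square_integrable_cmult square_integrable_mult_poly)
  then show ?thesis by (simp add: bounded_ops_def)
qed

text \<open>Complex differentiability in the operator norm.\<close>

definition has_op_derivative ::
  "(complex \<Rightarrow> (l2 \<Rightarrow>\<^sub>L l2)) \<Rightarrow> (l2 \<Rightarrow>\<^sub>L l2) \<Rightarrow> complex filter \<Rightarrow> bool" where
  "has_op_derivative f D F \<longleftrightarrow> (f has_derivative (\<lambda>h. scaleC_op h D)) F"

definition op_deriv :: "(complex \<Rightarrow> (l2 \<Rightarrow>\<^sub>L l2)) \<Rightarrow> complex \<Rightarrow> (l2 \<Rightarrow>\<^sub>L l2)" where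
  "op_deriv f z = (SOME D. has_op_derivative f D (at z))"

definition op_holomorphic_on :: "(complex \<Rightarrow> (l2 \<Rightarrow>\<^sub>L l2)) \<Rightarrow> complex set \<Rightarrow> bool" where
  "op_holomorphic_on f S \<longleftrightarrow>
     (\<forall>z\<in>S. f z \<in> bounded_ops) \<and> (\<forall>z\<in>S. \<exists>D\<in>bounded_ops. has_op_derivative f D (at z within S))"


section \<open>Holomorphic functions of two variables\<close>

definition bidisc :: "(complex \<times> complex) set" where
  "bidisc = ball 0 1 \<times> ball 0 1"

definition holomorphic2_on :: "(complex \<times> complex \<Rightarrow> complex) \<Rightarrow> (complex \<times> complex) set \<Rightarrow> bool"
  where
  "holomorphic2_on q S \<longleftrightarrow>
     (\<forall>z\<in>S. \<exists>a b. (q has_derivative (\<lambda>(h1, h2). a * h1 + b * h2)) (at z within S))"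

definition partial_deriv ::
  "nat \<times> nat \<Rightarrow> (complex \<times> complex \<Rightarrow> complex) \<Rightarrow> complex \<times> complex \<Rightarrow> complex" where
  "partial_deriv k q z =
     (deriv ^^ fst k) (\<lambda>w1. (deriv ^^ snd k) (\<lambda>w2. q (w1, w2)) (snd z)) (fst z)"

text \<open>Extended-valued, so that it is \<open>\<infinity>\<close> for an unbounded function.\<close>

definition sup_norm :: "'a set \<Rightarrow> ('a \<Rightarrow> 'b::real_normed_vector) \<Rightarrow> ennreal" where
  "sup_norm S g = (SUP z\<in>S. ennreal (norm (g z)))"

end

theory Submission
  imports Defs "HOL-Complex_Analysis.Complex_Analysis"
begin

text \<open>
Both sides of the equivalence describe the same family of power series. Restrict a function \<open>G\<close> on the
bidisc to the line \<open>w \<mapsto> (w, w * \<zeta>)\<close> with \<open>\<bar>\<zeta>\<bar> = 1\<close>. The homogeneous part of degree \<open>k\<close> of \<open>G\<close> becomes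
\<open>w^k * P k \<zeta>\<close> for a polynomial \<open>P k\<close> of degree at most \<open>k\<close>, and every such polynomial arises in this way,
from its homogenization \<open>z1^k * P k (z2 / z1)\<close>. So \<open>G\<close> corresponds to \<open>f w = (\<Sum>k. w^k * M (P k))\<close>, where
\<open>M\<close> denotes multiplication, and \<open>f w\<close> is multiplication by \<open>\<zeta> \<mapsto> G (w, w * \<zeta>)\<close>. The norm of a
multiplication operator is the supremum of its symbol on the circle (\<open>norm_mult_op_le\<close>,
\<open>poly_le_norm_mult_op\<close>), hence \<open>f\<close> is bounded by 1 if and only if \<open>G\<close> is bounded by 1 on all tori
\<open>\<bar>z1\<bar> = \<bar>z2\<bar> < 1\<close>. By the maximum principle in each variable (\<open>polydisc_maximum_principle\<close>) this is
boundedness by 1 on the bidisc. Prescribing \<open>P 0\<close>, \<open>P 1\<close>, \<open>P 2\<close> is the same as prescribing the Taylor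
polynomial of degree 2 of \<open>G\<close>.

From \<open>G\<close> to \<open>f\<close>, the analytic input is the Taylor expansion of a bounded function of two variables
(\<open>homogenization_sums\<close>). It is derived from the theory of one variable: the Taylor coefficients in the
second variable are holomorphic in the first, being uniform limits of difference quotients
(\<open>slice_deriv_holomorphic\<close>). The inequality \<open>\<bar>p2\<bar> \<le> 1 - \<bar>p1\<bar>\<^sup>2\<close> is the Schwarz--Pick bound on the
coefficients of \<open>w\<close> and \<open>w\<^sup>2\<close> in \<open>G (w, w * \<zeta>)\<close> (\<open>schwarz_pick_coefficients\<close>).

From \<open>f\<close> to \<open>G\<close>, an operator-valued function that is merely differentiable must first be expanded in a
power series (\<open>op_holomorphic_imp_power_series\<close>). The coefficients are Cauchy integrals in the Banach space
of operators, which is complete because the Hilbert space is, and they are identified by means of scalar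
matrix coefficients. The homogenized series then defines \<open>G\<close> (\<open>holomorphic2_on_homogenization_series\<close>).
\<close>

section \<open>Completeness of the Hilbert space\<close>

lemma l2_rel_self_iff: "l2_rel g g \<longleftrightarrow> square_integrable g"
  by (simp add: l2_rel_def)

lemma square_integrable_rep_l2: "square_integrable (rep_l2 x)"
  using Quotient_rep_reflp[OF Quotient_l2, of x] by (simp add: l2_rel_self_iff)

lemma l2_cases:
  obtains g where "square_integrable g" "x = abs_l2 g"
  using Quotient_abs_rep[OF Quotient_l2, of x] square_integrable_rep_l2[of x] by metis

lemma diff_abs_l2:
  "square_integrable g \<Longrightarrow> square_integrable h \<Longrightarrow> abs_l2 g - abs_l2 h = abs_l2 (\<lambda>z. g z - h z)"
  by (simp add: minus_l2.abs_eq l2_rel_self_iff)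

lemma nn_integral_norm_abs_l2:
  assumes "square_integrable g"
  shows "(\<integral>\<^sup>+z. ennreal ((cmod (g z))\<^sup>2) \<partial>circle_measure) = ennreal ((norm (abs_l2 g))\<^sup>2)"
  using assms by (simp add: norm_l2.abs_eq l2_rel_self_iff square_integrable_def nn_integral_eq_integral)

text \<open>Fatou's lemma for the squared moduli. It is used twice in the completeness proof: to see that a
pointwise limit lies in the space at all, and to bound its distance to the approximating sequence.\<close>

lemma Fatou_square_integrable:
  assumes sq: "\<And>n. square_integrable (g n)" and h: "h \<in> borel_measurable circle_measure"
    and lim: "AE z in circle_measure. (\<lambda>n. g n z) \<longlonglongrightarrow> h z"
    and bd: "\<And>n. norm (abs_l2 (g n)) \<le> C"
  shows "square_integrable h \<and> norm (abs_l2 h) \<le> C"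
proof -
  have gm: "\<And>n. g n \<in> borel_measurable circle_measure"
    using sq by (simp add: square_integrable_def)
  have C0: "0 \<le> C" using bd[of 0] norm_ge_zero order_trans by blast
  have "(\<integral>\<^sup>+z. ennreal ((cmod (h z))\<^sup>2) \<partial>circle_measure)
      = (\<integral>\<^sup>+z. liminf (\<lambda>n. ennreal ((cmod (g n z))\<^sup>2)) \<partial>circle_measure)"
  proof (rule nn_integral_cong_AE, use lim in eventually_elim)
    fix z assume "(\<lambda>n. g n z) \<longlonglongrightarrow> h z"
    then have "(\<lambda>n. ennreal ((cmod (g n z))\<^sup>2)) \<longlonglongrightarrow> ennreal ((cmod (h z))\<^sup>2)"
      by (intro tendsto_intros tendsto_ennrealI)
    then show "ennreal ((cmod (h z))\<^sup>2) = liminf (\<lambda>n. ennreal ((cmod (g n z))\<^sup>2))"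
      by (rule lim_imp_Liminf[OF sequentially_bot, symmetric])
  qed
  also have "\<dots> \<le> liminf (\<lambda>n. \<integral>\<^sup>+z. ennreal ((cmod (g n z))\<^sup>2) \<partial>circle_measure)"
    by (rule nn_integral_liminf) (use gm in measurable)
  also have "\<dots> \<le> liminf (\<lambda>n. ennreal (C\<^sup>2))"
    using bd by (intro Liminf_mono always_eventually allI) (auto simp: nn_integral_norm_abs_l2 sq intro!: ennreal_leI power_mono)
  finally have le: "(\<integral>\<^sup>+z. ennreal ((cmod (h z))\<^sup>2) \<partial>circle_measure) \<le> ennreal (C\<^sup>2)"
    by (simp add: Liminf_const)
  have hs: "square_integrable h"
    unfolding square_integrable_def
  proof
    show "integrable circle_measure (\<lambda>z. (cmod (h z))\<^sup>2)"
      using le h by (intro integrableI_bounded) (auto intro: le_less_trans)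
  qed (rule h)
  moreover have "(norm (abs_l2 h))\<^sup>2 \<le> C\<^sup>2"
    using le by (simp add: nn_integral_norm_abs_l2[OF hs])
  then have "norm (abs_l2 h) \<le> C" using C0 by (rule power2_le_imp_le)
  ultimately show ?thesis by blast
qed

text \<open>The integral of \<open>\<Sum>n. 4^n * \<bar>u n z\<bar>\<^sup>2\<close> is at most \<open>\<Sum>n. 4^n * (1/16)^n\<close>, hence finite, and the series
converges almost everywhere. Where it does, its terms are eventually below 1, which says that
\<open>\<bar>u n z\<bar> \<le> (1/2)^n\<close>. The weight \<open>4^n\<close> thus trades a little decay of the norms for pointwise
summability.\<close>

lemma AE_summable_of_geometric_norms:
  assumes sq: "\<And>n. square_integrable (u n)" and bd: "\<And>n. norm (abs_l2 (u n)) \<le> (1/4)^n"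
  shows "AE z in circle_measure. summable (\<lambda>n. u n z)"
proof -
  have [measurable]: "\<And>n. u n \<in> borel_measurable circle_measure"
    using sq by (simp add: square_integrable_def)
  have "(\<integral>\<^sup>+z. (\<Sum>n. ennreal (4^n * (cmod (u n z))\<^sup>2)) \<partial>circle_measure)
      = (\<Sum>n. \<integral>\<^sup>+z. ennreal (4^n * (cmod (u n z))\<^sup>2) \<partial>circle_measure)"
    by (rule nn_integral_suminf) measurable
  also have "\<dots> = (\<Sum>n. ennreal (4^n * (norm (abs_l2 (u n)))\<^sup>2))"
    by (simp add: ennreal_mult nn_integral_cmult nn_integral_norm_abs_l2 sq)
  also have "\<dots> \<le> (\<Sum>n. ennreal ((1/4)^n))"
  proof (rule suminf_le)
    fix n
    have "4^n * (norm (abs_l2 (u n)))\<^sup>2 \<le> 4^n * ((1/4::real)^n)\<^sup>2"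
      using bd by (intro mult_left_mono power_mono) auto
    also have "\<dots> = (1/4)^n" by (simp add: power2_eq_square field_simps)
    finally show "ennreal (4^n * (norm (abs_l2 (u n)))\<^sup>2) \<le> ennreal ((1/4)^n)"
      by (rule ennreal_leI)
  qed auto
  also have "\<dots> = ennreal (\<Sum>n. (1/4)^n)"
    by (rule suminf_ennreal2) (auto simp: summable_geometric)
  also have "\<dots> < \<infinity>" by simp
  finally have "(\<integral>\<^sup>+z. (\<Sum>n. ennreal (4^n * (cmod (u n z))\<^sup>2)) \<partial>circle_measure) \<noteq> \<infinity>"
    by simp
  then have "AE z in circle_measure. (\<Sum>n. ennreal (4^n * (cmod (u n z))\<^sup>2)) \<noteq> \<infinity>"
    by (intro nn_integral_PInf_AE) measurable
  then show ?thesis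
  proof eventually_elim
    fix z assume fin: "(\<Sum>n. ennreal (4^n * (cmod (u n z))\<^sup>2)) \<noteq> \<infinity>"
    have "summable (\<lambda>n. 4^n * (cmod (u n z))\<^sup>2)"
      by (rule summable_suminf_not_top) (use fin in auto)
    then have "(\<lambda>n. 4^n * (cmod (u n z))\<^sup>2) \<longlonglongrightarrow> 0" by (rule summable_LIMSEQ_zero)
    then have "eventually (\<lambda>n. 4^n * (cmod (u n z))\<^sup>2 < 1) sequentially"
      by (rule order_tendstoD) simp
    then have "eventually (\<lambda>n. norm (u n z) \<le> (1/2)^n) sequentially"
    proof eventually_elim
      fix n assume a: "4^n * (cmod (u n z))\<^sup>2 < 1"
      have "(2^n * cmod (u n z))\<^sup>2 = 4^n * (cmod (u n z))\<^sup>2"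
        by (simp add: power2_eq_square mult_ac flip: power_mult_distrib)
      then have "(2^n * cmod (u n z))\<^sup>2 \<le> 1\<^sup>2" using a by simp
      then have "2^n * cmod (u n z) \<le> 1" by (rule power2_le_imp_le) simp
      then show "norm (u n z) \<le> (1/2)^n" by (simp add: field_simps)
    qed
    then show "summable (\<lambda>n. u n z)"
      by (rule summable_comparison_test_ev) (simp add: summable_geometric)
  qed
qed

text \<open>The Riesz--Fischer theorem. A subsequence with increments of norm at most \<open>(1/4)^n\<close> converges almost
everywhere, and Fatou's lemma shows that its pointwise limit is also its limit in norm. Completeness
is inherited by the bounded operators on the space, so that operator-valued series and integrals
make sense.\<close>

instance l2 :: banach
proof
  fix X :: "nat \<Rightarrow> l2" assume C: "Cauchy X"
  have "\<exists>N. \<forall>m\<ge>N. \<forall>n\<ge>N. norm (X m - X n) < (1/4)^k" for k :: nat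
    using C by (simp add: Cauchy_iff)
  then obtain N where N: "\<And>k m n. m \<ge> N k \<Longrightarrow> n \<ge> N k \<Longrightarrow> norm (X m - X n) < (1/4)^k"
    by metis
  \<comment> \<open>The summand \<open>k\<close> makes the index sequence strictly increasing, and the sum of the thresholds puts
\<open>r k\<close> beyond every \<open>N j\<close> with \<open>j \<le> k\<close>.\<close>
  define r where "r k = k + (\<Sum>i\<le>k. N i)" for k
  have rN: "N k \<le> r k" for k
    unfolding r_def by (simp add: trans_le_add2 member_le_sum)
  have "strict_mono r" by (rule strict_monoI_Suc) (simp add: r_def)
  have mr: "j \<le> k \<Longrightarrow> N j \<le> r k" for j k
    using rN[of j] \<open>strict_mono r\<close> by (meson order_trans strict_mono_less_eq)
  define g where "g n = rep_l2 (X (r n))" for n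
  have sq: "square_integrable (g n)" for n by (simp add: g_def square_integrable_rep_l2)
  have Xg: "X (r n) = abs_l2 (g n)" for n
    by (simp add: g_def Quotient_abs_rep[OF Quotient_l2])
  have "AE z in circle_measure. summable (\<lambda>n. g (Suc n) z - g n z)"
  proof (rule AE_summable_of_geometric_norms)
    show "square_integrable (\<lambda>z. g (Suc n) z - g n z)" for n
      by (intro square_integrable_diff sq)
    have "norm (X (r (Suc n)) - X (r n)) < (1/4)^n" for n
      by (intro N mr) auto
    then show "norm (abs_l2 (\<lambda>z. g (Suc n) z - g n z)) \<le> (1/4)^n" for n
      by (simp add: Xg diff_abs_l2 sq less_imp_le)
  qed
  then have conv: "AE z in circle_measure. (\<lambda>n. g n z) \<longlonglongrightarrow> lim (\<lambda>n. g n z)"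
  proof eventually_elim
    fix z assume "summable (\<lambda>n. g (Suc n) z - g n z)"
    then have "convergent (\<lambda>n. (\<Sum>i<n. g (Suc i) z - g i z))" by (simp add: summable_iff_convergent)
    then have "convergent (\<lambda>n. g n z - g 0 z)" by (simp add: sum_lessThan_telescope[where f = "\<lambda>n. g n z"])
    then have "convergent (\<lambda>n. (g n z - g 0 z) + g 0 z)" by (intro convergent_add convergent_const)
    then show "(\<lambda>n. g n z) \<longlonglongrightarrow> lim (\<lambda>n. g n z)" by (simp add: convergent_LIMSEQ_iff)
  qed
  define h where "h z = lim (\<lambda>n. g n z)" for z
  have gm: "\<And>n. g n \<in> borel_measurable circle_measure"
    using sq by (simp add: square_integrable_def)
  have hm: "h \<in> borel_measurable circle_measure"
    unfolding h_def by (rule borel_measurable_lim_metric) (rule gm)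
  have key: "square_integrable (\<lambda>z. h z - g k z) \<and> norm (abs_l2 (\<lambda>z. h z - g k z)) \<le> (1/4)^k" for k
  proof (rule Fatou_square_integrable[where g = "\<lambda>n z. g (n + k) z - g k z"])
    show "square_integrable (\<lambda>z. g (n + k) z - g k z)" for n
      by (intro square_integrable_diff sq)
    show "(\<lambda>z. h z - g k z) \<in> borel_measurable circle_measure"
      using gm hm by measurable
    have "norm (X (r (n + k)) - X (r k)) < (1/4)^k" for n
      by (intro N mr) auto
    then show "norm (abs_l2 (\<lambda>z. g (n + k) z - g k z)) \<le> (1/4)^k" for n
      by (simp add: Xg diff_abs_l2 sq less_imp_le)
    show "AE z in circle_measure. (\<lambda>n. g (n + k) z - g k z) \<longlonglongrightarrow> h z - g k z"
      using conv by eventually_elim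
        (intro tendsto_intros, auto simp: h_def intro: LIMSEQ_ignore_initial_segment)
  qed
  have hs: "square_integrable h"
    using square_integrable_add[OF conjunct1[OF key[of 0]] sq[of 0]] by simp
  have "(\<lambda>k. X (r k)) \<longlonglongrightarrow> abs_l2 h"
  proof (rule LIM_zero_cancel, rule Lim_null_comparison)
    show "eventually (\<lambda>k. norm (X (r k) - abs_l2 h) \<le> (1/4)^k) sequentially"
      using key by (subst norm_minus_commute) (auto simp: Xg diff_abs_l2 hs sq)
    show "(\<lambda>k. (1/4::real)^k) \<longlonglongrightarrow> 0" by (rule LIMSEQ_power_zero) simp
  qed
  then have "X \<longlonglongrightarrow> abs_l2 h"
    using Cauchy_converges_subseq[OF C \<open>strict_mono r\<close>] by (simp add: o_def)
  then show "convergent X" by (rule convergentI)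
qed

section \<open>Complex scalars and multiplication operators\<close>

lemma scaleC_simps:
  "scaleC (a + b) x = scaleC a x + scaleC b x"
  "scaleC c (x + y) = scaleC c x + scaleC c y"
  "scaleC (a * b) x = scaleC a (scaleC b x)"
  "scaleC 1 x = x"
  "scaleC (complex_of_real r) x = r *\<^sub>R x"
proof -
  show "scaleC (a + b) x = scaleC a x + scaleC b x"
    by transfer (auto simp: l2_rel_def algebra_simps intro!: square_integrable_add square_integrable_cmult)
  show "scaleC c (x + y) = scaleC c x + scaleC c y"
    by (rule linear_add[OF bounded_linear.linear[OF bounded_linear_scaleC]])
  show "scaleC (a * b) x = scaleC a (scaleC b x)"
    using square_integrable_cmult[of _ "a * b"] by transfer (auto simp: l2_rel_def mult.assoc)
  show "scaleC 1 x = x" by transfer (auto simp: l2_rel_def)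
  show "scaleC (complex_of_real r) x = r *\<^sub>R x"
    by transfer (auto simp: l2_rel_def scaleR_conv_of_real intro!: square_integrable_cmult)
qed

text \<open>Multiplication by the constant \<open>c\<close> has norm at most \<open>\<bar>c\<bar>\<close>; applying this to \<open>inverse c\<close> as well gives
equality.\<close>

lemma norm_scaleC: "norm (scaleC c x) = cmod c * norm x"
proof -
  have le: "norm (scaleC c x) \<le> cmod c * norm x" for c x
    unfolding scaleC_eq_mult_poly by (rule norm_mult_poly_le) auto
  show ?thesis
  proof (cases "c = 0")
    case True
    then show ?thesis using le[of 0 x] by simp
  next
    case False
    have "norm x = norm (scaleC (inverse c) (scaleC c x))"
      using False by (simp flip: scaleC_simps(3)) (simp add: scaleC_simps)
    also have "\<dots> \<le> cmod (inverse c) * norm (scaleC c x)" by (rule le)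
    finally have "cmod c * norm x \<le> norm (scaleC c x)"
      using False by (simp add: norm_divide field_simps)
    then show ?thesis using le[of c x] by simp
  qed
qed

lemma scaleC_op_simps:
  "scaleC_op (a + b) T = scaleC_op a T + scaleC_op b T"
  "scaleC_op c (S + T) = scaleC_op c S + scaleC_op c T"
  "scaleC_op (a * b) T = scaleC_op a (scaleC_op b T)"
  "scaleC_op 1 T = T"
  "scaleC_op (complex_of_real r) T = r *\<^sub>R T"
  by (rule blinfun_eqI; simp add: scaleC_simps blinfun.add_left blinfun.scaleR_left)+

lemma norm_scaleC_op: "norm (scaleC_op c T) = cmod c * norm T"
proof -
  have le: "norm (scaleC_op c T) \<le> cmod c * norm T" for c T
    by (rule norm_blinfun_bound)
      (simp_all add: norm_scaleC mult.assoc mult_left_mono norm_blinfun)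
  show ?thesis
  proof (cases "c = 0")
    case True
    then show ?thesis using le[of 0 T] by simp
  next
    case False
    have "norm T = norm (scaleC_op (inverse c) (scaleC_op c T))"
      using False by (simp flip: scaleC_op_simps(3)) (simp add: scaleC_op_simps)
    also have "\<dots> \<le> cmod (inverse c) * norm (scaleC_op c T)" by (rule le)
    finally have "cmod c * norm T \<le> norm (scaleC_op c T)"
      using False by (simp add: norm_divide field_simps)
    then show ?thesis using le[of c T] by simp
  qed
qed

text \<open>As a real bilinear map, complex scalar multiplication of operators gets the library's calculus of
limits, derivatives and series.\<close>

lemma bounded_bilinear_scaleC_op: "bounded_bilinear scaleC_op"
proof
  have r: "scaleC_op (r *\<^sub>R a) T = r *\<^sub>R scaleC_op a T" for r a T
    by (simp add: scaleR_conv_of_real scaleC_op_simps)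
  show "scaleC_op (r *\<^sub>R a) T = r *\<^sub>R scaleC_op a T" for r a T by (rule r)
  show "scaleC_op a (r *\<^sub>R T) = r *\<^sub>R scaleC_op a T" for r a T
    unfolding r[symmetric] by (simp add: scaleR_conv_of_real mult.commute scaleC_op_simps(3)
        flip: scaleC_op_simps(5))
  show "\<exists>K. \<forall>a T. norm (scaleC_op a T) \<le> norm a * norm T * K"
    by (rule exI[of _ 1]) (simp add: norm_scaleC_op)
qed (simp_all add: scaleC_op_simps)

interpretation scaleC_op: bounded_bilinear scaleC_op
  by (rule bounded_bilinear_scaleC_op)

lemma mult_poly_smult: "mult_poly (smult c p) x = scaleC c (mult_poly p x)"
proof (cases x rule: l2_cases)
  case (1 g)
  then show ?thesis
    by (simp add: mult_poly.abs_eq scaleC.abs_eq l2_rel_self_iff square_integrable_mult_poly mult.assoc)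
qed

lemma mult_poly_add: "mult_poly (p + q) x = mult_poly p x + mult_poly q x"
proof (cases x rule: l2_cases)
  case (1 g)
  then show ?thesis
    by (simp add: mult_poly.abs_eq plus_l2.abs_eq l2_rel_self_iff square_integrable_mult_poly distrib_right)
qed

lemma scaleC_op_mult_op: "scaleC_op c (mult_op p) = mult_op (smult c p)"
  by (rule blinfun_eqI) (simp only: blinfun_apply_scaleC_op blinfun_apply_mult_op mult_poly_smult)

lemma mult_op_add: "mult_op (p + q) = mult_op p + mult_op q"
  by (rule blinfun_eqI) (simp only: blinfun.add_left blinfun_apply_mult_op mult_poly_add)

lemma mult_op_0: "mult_op 0 = 0"
  by (rule add_left_imp_eq[of "mult_op 0"]) (simp only: add_0_right flip: mult_op_add)

lemma mult_op_sum: "mult_op (sum p A) = (\<Sum>i\<in>A. mult_op (p i))"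
  by (induction A rule: infinite_finite_induct) (simp_all add: mult_op_0 mult_op_add)

lemma norm_mult_op_le:
  "B \<ge> 0 \<Longrightarrow> (\<And>z. z \<in> sphere 0 1 \<Longrightarrow> cmod (poly p z) \<le> B) \<Longrightarrow> norm (mult_op p) \<le> B"
  by (rule norm_blinfun_bound) (simp_all only: blinfun_apply_mult_op norm_mult_poly_le)

text \<open>If \<open>\<bar>p \<zeta>\<bar>\<close> exceeded the norm of the multiplication operator, then so would \<open>\<bar>p\<bar>\<close> on an open arc around
\<open>\<zeta>\<close>, and the operator would stretch the indicator function of that arc by a factor larger than the norm of
the operator. Together with \<open>norm_mult_op_le\<close> this says that the operator norm is the maximum modulus on the circle.\<close>

lemma poly_le_norm_mult_op:
  assumes \<zeta>: "\<zeta> \<in> sphere 0 1"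
  shows "cmod (poly p \<zeta>) \<le> norm (mult_op p)"
proof (rule ccontr)
  assume "\<not> ?thesis"
  then obtain m where m: "norm (mult_op p) < m" "m < cmod (poly p \<zeta>)"
    using dense by (metis not_le)
  then have m0: "0 < m" using norm_ge_zero le_less_trans by blast
  define U where "U = {z. m < cmod (poly p z)}"
  have "open U" unfolding U_def by (intro open_Collect_less continuous_intros)
  have U_borel [measurable]: "U \<inter> sphere 0 1 \<in> sets circle_measure"
    using \<open>open U\<close> by (auto simp: sets_circle_measure sets_restrict_space)
  obtain t where t: "0 \<le> t" "t < 2 * pi" "\<zeta> = cis t"
    using \<zeta> Arg2pi[of \<zeta>] by (auto simp: is_Arg_def cis_conv_exp)
  have "open (cis -` U)" by (intro open_vimage \<open>open U\<close> continuous_intros)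
  moreover have "t \<in> cis -` U" using t m by (auto simp: U_def)
  ultimately obtain e where e: "e > 0" "\<And>s. \<bar>s - t\<bar> < e \<Longrightarrow> cis s \<in> U"
    unfolding open_dist by (auto simp: dist_real_def)
  have fin: "emeasure circle_measure (U \<inter> sphere 0 1) < \<infinity>" and
    pos: "emeasure circle_measure (U \<inter> sphere 0 1) > 0"
  proof -
    have cm: "cis \<in> measurable (uniform_measure lborel {0..2 * pi}) (restrict_space borel (sphere 0 1))"
    proof (rule measurable_restrict_space2)
      have "cis \<in> borel_measurable lborel"
        by (simp add: borel_measurable_continuous_onI continuous_on_cis)
      then show "cis \<in> borel_measurable (uniform_measure lborel {0..2 * pi})" by simp
    qed simp
    have eq: "emeasure circle_measure (U \<inter> sphere 0 1)
       = emeasure lborel ({0..2 * pi} \<inter> cis -` U) / emeasure lborel {0..2*pi}"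
    proof -
      have "emeasure circle_measure (U \<inter> sphere 0 1)
        = emeasure (uniform_measure lborel {0..2 * pi}) (cis -` (U \<inter> sphere 0 1) \<inter> UNIV)"
        unfolding circle_measure_def using U_borel
        by (subst emeasure_distr[OF cm]) (auto simp: sets_circle_measure)
      also have "cis -` (U \<inter> sphere 0 1) \<inter> UNIV = cis -` U" by auto
      also have "emeasure (uniform_measure lborel {0..2 * pi}) (cis -` U)
        = emeasure lborel ({0..2 * pi} \<inter> cis -` U) / emeasure lborel {0..2*pi}"
        using \<open>open (cis -` U)\<close> by (intro emeasure_uniform_measure) auto
      finally show ?thesis .
    qed
    have "emeasure lborel ({0..2 * pi} \<inter> cis -` U) \<le> emeasure lborel {0..2*pi}"
      using \<open>open (cis -` U)\<close> by (intro emeasure_mono) auto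
    then have "emeasure lborel ({0..2 * pi} \<inter> cis -` U) < \<infinity>"
      by (rule le_less_trans) simp
    then show "emeasure circle_measure (U \<inter> sphere 0 1) < \<infinity>"
      unfolding eq by (simp add: ennreal_divide_eq_top_iff less_top[symmetric])
    \<comment> \<open>As \<open>t < 2 * pi\<close>, the arc contains the image of an interval to the right of \<open>t\<close> inside \<open>{0..2 * pi}\<close>.\<close>
    define d where "d = min (e/2) (2 * pi - t)"
    have d: "d > 0" using e t by (simp add: d_def)
    have "0 < emeasure lborel {t..t+d}" using d by simp
    also have "\<dots> \<le> emeasure lborel ({0..2 * pi} \<inter> cis -` U)"
      using \<open>open (cis -` U)\<close> t e d by (intro emeasure_mono) (auto simp: d_def)
    finally have "0 < emeasure lborel ({0..2 * pi} \<inter> cis -` U)" .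
    then show "0 < emeasure circle_measure (U \<inter> sphere 0 1)"
      unfolding eq by (simp add: ennreal_zero_less_divide)
  qed
  define \<mu> where "\<mu> = measure circle_measure (U \<inter> sphere 0 1)"
  have \<mu>: "\<mu> > 0" using pos fin
    by (simp add: \<mu>_def measure_def enn2real_positive_iff)
  define g :: "complex \<Rightarrow> complex" where "g z = indicator (U \<inter> sphere 0 1) z" for z
  have gsq: "(cmod (g z))\<^sup>2 = indicator (U \<inter> sphere 0 1) z" for z
    by (simp add: g_def indicator_def)
  have gi: "integrable circle_measure (indicator (U \<inter> sphere 0 1) :: _ \<Rightarrow> real)"
    using fin by (intro integrable_real_indicator) auto
  have sq: "square_integrable g"
    unfolding square_integrable_def gsq
  proof
    show "g \<in> borel_measurable circle_measure"
      unfolding g_def[abs_def] by (intro borel_measurable_indicator U_borel)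
  qed (rule gi)
  have ng: "norm (abs_l2 g) = sqrt \<mu>"
    using fin by (simp add: norm_l2.abs_eq l2_rel_self_iff sq gsq \<mu>_def)
  have sq2: "square_integrable (\<lambda>z. poly p z * g z)" by (rule square_integrable_mult_poly[OF sq])
  have "m\<^sup>2 * \<mu> = (\<integral>z. m\<^sup>2 * indicator (U \<inter> sphere 0 1) z \<partial>circle_measure)"
    using fin by (simp add: \<mu>_def)
  also have "\<dots> \<le> (\<integral>z. (cmod (poly p z * g z))\<^sup>2 \<partial>circle_measure)"
  proof (rule integral_mono)
    show "integrable circle_measure (\<lambda>z. (cmod (poly p z * g z))\<^sup>2)"
      using sq2 by (simp add: square_integrable_def)
    show "m\<^sup>2 * indicator (U \<inter> sphere 0 1) z \<le> (cmod (poly p z * g z))\<^sup>2" for z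
      using m0 by (auto simp: g_def U_def indicator_def norm_mult intro!: power_mono)
  qed (use gi in simp)
  also have "\<dots> = (norm (mult_poly p (abs_l2 g)))\<^sup>2"
    by (simp add: mult_poly.abs_eq norm_l2.abs_eq l2_rel_self_iff sq sq2)
  finally have "m\<^sup>2 * \<mu> \<le> (norm (mult_poly p (abs_l2 g)))\<^sup>2" .
  then have "(m * sqrt \<mu>)\<^sup>2 \<le> (norm (mult_poly p (abs_l2 g)))\<^sup>2"
    using \<mu> by (simp add: power_mult_distrib)
  then have "m * sqrt \<mu> \<le> norm (mult_poly p (abs_l2 g))"
    by (rule power2_le_imp_le) simp
  also have "\<dots> \<le> norm (mult_op p) * sqrt \<mu>"
    using norm_blinfun[of "mult_op p" "abs_l2 g"] by (simp add: ng)
  finally show False using m \<mu> by simp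
qed

section \<open>Power series with operator coefficients\<close>

text \<open>A summable majorant of the derivatives makes the tails of the differentiated series small in operator
norm, uniformly in the point; that is the hypothesis under which the library differentiates term by
term. The domain may have any dimension: it is the unit disc for operator-valued series and the bidisc
for functions of two variables.\<close>

lemma has_derivative_series_M_test:
  fixes f :: "nat \<Rightarrow> 'a::real_normed_vector \<Rightarrow> 'b::banach"
  assumes S: "convex S" "x0 \<in> S" and x0: "summable (\<lambda>n. f n x0)"
    and der: "\<And>n x. x \<in> S \<Longrightarrow> (f n has_derivative f' n x) (at x within S)"
    and bd: "\<And>n x h. x \<in> S \<Longrightarrow> norm (f' n x h) \<le> M n * norm h"
    and M: "summable M"
  shows "\<exists>g. \<forall>x\<in>S. (\<lambda>n. f n x) sums g x
           \<and> (g has_derivative (\<lambda>h. \<Sum>n. f' n x h)) (at x within S)"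
proof (rule has_derivative_series[OF S(1) der _ S(2) summable_sums[OF x0]])
  fix e :: real assume "e > 0"
  then obtain N where N: "\<And>n. n \<ge> N \<Longrightarrow> norm (\<Sum>i. M (i + n)) < e"
    using suminf_exist_split[OF _ M] by blast
  show "\<forall>\<^sub>F n in sequentially. \<forall>x\<in>S. \<forall>h.
      norm ((\<Sum>i<n. f' i x h) - (\<Sum>n. f' n x h)) \<le> e * norm h"
  proof (intro eventually_sequentiallyI[of N] ballI allI)
    fix n x and h :: 'a assume n: "n \<ge> N" and x: "x \<in> S"
    have sM: "summable (\<lambda>i. M i * norm h)" by (intro summable_mult2 M)
    have sf: "summable (\<lambda>i. norm (f' i x h))"
      by (rule summable_comparison_test_ev[OF _ sM]) (use bd x in auto)
    have "(\<Sum>i. f' i x h) = (\<Sum>i. f' (i + n) x h) + (\<Sum>i<n. f' i x h)"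
      by (rule suminf_split_initial_segment) (rule summable_norm_cancel[OF sf])
    then have "norm ((\<Sum>i<n. f' i x h) - (\<Sum>n. f' n x h)) = norm (\<Sum>i. f' (i + n) x h)"
      by (simp add: norm_minus_commute)
    also have "\<dots> \<le> (\<Sum>i. norm (f' (i + n) x h))"
      by (rule summable_norm[OF summable_ignore_initial_segment[OF sf]])
    also have "\<dots> \<le> (\<Sum>i. M (i + n) * norm h)"
      using bd x summable_ignore_initial_segment[OF sf] summable_ignore_initial_segment[OF sM]
      by (intro suminf_le) auto
    also have "\<dots> = (\<Sum>i. M (i + n)) * norm h"
      by (rule suminf_mult2[symmetric, OF summable_ignore_initial_segment[OF M]])
    also have "\<dots> \<le> e * norm h"
      using N[OF n] by (intro mult_right_mono) auto
    finally show "norm ((\<Sum>i<n. f' i x h) - (\<Sum>n. f' n x h)) \<le> e * norm h" .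
  qed
qed

text \<open>Absolute convergence on the smaller discs is required separately because it transfers to the
differentiated series by a statement about real power series only.\<close>

definition op_power_series_on :: "real \<Rightarrow> (nat \<Rightarrow> l2 \<Rightarrow>\<^sub>L l2) \<Rightarrow> (complex \<Rightarrow> l2 \<Rightarrow>\<^sub>L l2) \<Rightarrow> bool" where
  "op_power_series_on r T f \<longleftrightarrow>
     (\<forall>s. 0 \<le> s \<and> s < r \<longrightarrow> summable (\<lambda>n. norm (T n) * s ^ n)) \<and>
     (\<forall>z\<in>ball 0 r. (\<lambda>n. scaleC_op (z ^ n) (T n)) sums f z)"

definition op_diffs :: "(nat \<Rightarrow> l2 \<Rightarrow>\<^sub>L l2) \<Rightarrow> nat \<Rightarrow> l2 \<Rightarrow>\<^sub>L l2" where
  "op_diffs T n = real (Suc n) *\<^sub>R T (Suc n)"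

lemma summable_op_diffs:
  assumes "\<And>s. 0 \<le> s \<Longrightarrow> s < r \<Longrightarrow> summable (\<lambda>n. norm (T n) * s ^ n)" and s: "0 \<le> s" "s < r"
  shows "summable (\<lambda>n. norm (op_diffs T n) * s ^ n)"
proof -
  have "summable (\<lambda>n. norm (T n) * x ^ n)" if "norm x < r" for x :: real
    by (rule summable_norm_cancel)
      (use assms(1)[of "norm x"] that in \<open>simp add: abs_mult power_abs\<close>)
  then have "summable (\<lambda>n. diffs (\<lambda>n. norm (T n)) n * s ^ n)"
    using s by (intro termdiff_converges[where K = r]) auto
  then show ?thesis by (simp add: diffs_def op_diffs_def)
qed

text \<open>On a disc of radius \<open>s < r\<close> around 0 that contains \<open>z\<close> the terms have derivatives bounded by
\<open>norm (T n) * n * s^(n - 1)\<close>, a summable sequence.\<close>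

lemma op_power_series_termdiff:
  assumes ps: "op_power_series_on r T f" and z: "z \<in> ball 0 r"
  shows "(\<lambda>n. scaleC_op (z ^ n) (op_diffs T n)) sums (\<Sum>n. scaleC_op (z ^ n) (op_diffs T n))"
    and "has_op_derivative f (\<Sum>n. scaleC_op (z ^ n) (op_diffs T n)) (at z)"
proof -
  have sm: "summable (\<lambda>n. norm (T n) * s ^ n)" if "0 \<le> s" "s < r" for s
    using ps that by (simp add: op_power_series_on_def)
  have sums: "(\<lambda>n. scaleC_op (w ^ n) (T n)) sums f w" if "w \<in> ball 0 r" for w
    using ps that by (simp add: op_power_series_on_def)
  obtain s where s: "norm z < s" "s < r" using z dense by (metis mem_ball_0)
  then have s0: "0 \<le> s" using norm_ge_zero[of z] by linarith
  define D where "D w = (\<Sum>n. scaleC_op (w ^ n) (op_diffs T n))" for w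
  have smD: "summable (\<lambda>n. norm (op_diffs T n) * s ^ n)"
    by (rule summable_op_diffs[OF sm s0 s(2)])
  have sumD: "(\<lambda>n. scaleC_op (w ^ n) (op_diffs T n)) sums D w" if "norm w < s" for w
    unfolding D_def
  proof (rule summable_sums, rule summable_comparison_test_ev[OF _ smD], rule always_eventually, rule allI)
    show "norm (scaleC_op (w ^ n) (op_diffs T n)) \<le> norm (op_diffs T n) * s ^ n" for n
      using that by (simp add: norm_scaleC_op norm_power mult.commute mult_right_mono power_mono)
  qed
  show "(\<lambda>n. scaleC_op (z ^ n) (op_diffs T n)) sums (\<Sum>n. scaleC_op (z ^ n) (op_diffs T n))"
    using sumD[OF s(1)] by (simp add: D_def)
  let ?f' = "\<lambda>n w h. scaleC_op (of_nat n * w ^ (n - 1) * h) (T n)"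
  have "\<exists>g. \<forall>w\<in>ball 0 s. (\<lambda>n. scaleC_op (w ^ n) (T n)) sums g w
           \<and> (g has_derivative (\<lambda>h. \<Sum>n. ?f' n w h)) (at w within ball 0 s)"
  proof (rule has_derivative_series_M_test[where M = "\<lambda>n. norm (T n) * (real n * s ^ (n - 1))" and ?x0.0 = z])
    show "((\<lambda>w. scaleC_op (w ^ n) (T n)) has_derivative ?f' n w) (at w within ball 0 s)" for n w
    proof (rule bounded_linear.has_derivative[OF scaleC_op.bounded_linear_left])
      have "((\<lambda>w. w ^ n) has_field_derivative of_nat n * w ^ (n - 1)) (at w within ball 0 s)"
        by (auto intro!: derivative_eq_intros)
      then show "((\<lambda>w. w ^ n) has_derivative (\<lambda>h. of_nat n * w ^ (n - 1) * h)) (at w within ball 0 s)"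
        by (simp add: has_field_derivative_def)
    qed
    show "norm (?f' n w h) \<le> norm (T n) * (real n * s ^ (n - 1)) * norm h" if "w \<in> ball 0 s" for n w h
    proof -
      have "real n * cmod w ^ (n - 1) * cmod h * norm (T n) \<le> real n * s ^ (n - 1) * cmod h * norm (T n)"
        using that by (intro mult_right_mono mult_left_mono power_mono) auto
      then show ?thesis by (simp add: norm_scaleC_op norm_mult norm_power mult_ac)
    qed
    show "summable (\<lambda>n. norm (T n) * (real n * s ^ (n - 1)))"
      using smD unfolding summable_Suc_iff[symmetric, of "\<lambda>n. norm (T n) * (real n * s ^ (n - 1))"]
      by (simp add: op_diffs_def mult_ac)
    show "summable (\<lambda>n. scaleC_op (z ^ n) (T n))"
      using sums[OF z] by (rule sums_summable)
  qed (use s in auto)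
  then obtain g where g: "\<And>w. w \<in> ball 0 s \<Longrightarrow> (\<lambda>n. scaleC_op (w ^ n) (T n)) sums g w"
    and dg: "\<And>w. w \<in> ball 0 s \<Longrightarrow> (g has_derivative (\<lambda>h. \<Sum>n. ?f' n w h)) (at w within ball 0 s)"
    by blast
  have gf: "g w = f w" if "w \<in> ball 0 s" for w
    using g[OF that] sums[of w] that s by (auto intro: sums_unique2)
  have zs: "z \<in> ball 0 s" using s by simp
  have "(\<Sum>n. ?f' n z h) = scaleC_op h (D z)" for h
  proof (rule sums_unique[symmetric])
    have "(\<lambda>n. scaleC_op h (scaleC_op (z ^ n) (op_diffs T n))) sums scaleC_op h (D z)"
      by (rule bounded_linear.sums[OF scaleC_op.bounded_linear_right sumD[OF s(1)]])
    moreover have "scaleC_op h (scaleC_op (z ^ n) (op_diffs T n)) = ?f' (Suc n) z h" for n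
      by (simp add: op_diffs_def scaleC_op.scaleR_right mult_ac del: of_nat_Suc
          flip: scaleC_op_simps(3) scaleC_op_simps(5))
    ultimately have "(\<lambda>n. ?f' (Suc n) z h) sums scaleC_op h (D z)" by simp
    then show "(\<lambda>n. ?f' n z h) sums scaleC_op h (D z)"
      by (subst (asm) sums_Suc_iff) (simp add: scaleC_op.zero_left)
  qed
  then have "(g has_derivative (\<lambda>h. scaleC_op h (D z))) (at z within ball 0 s)"
    using dg[OF zs] by simp
  then have "(f has_derivative (\<lambda>h. scaleC_op h (D z))) (at z within ball 0 s)"
    by (rule has_derivative_transform[OF zs, rotated]) (simp add: gf)
  then show "has_op_derivative f (\<Sum>n. scaleC_op (z ^ n) (op_diffs T n)) (at z)"
    using zs by (simp add: has_op_derivative_def at_within_open[OF zs open_ball] flip: D_def)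
qed

text \<open>A derivative \<open>h \<mapsto> h D\<close> is determined by its value at \<open>h = 1\<close>, so the choice made in \<open>op_deriv\<close> is the only
possible one.\<close>

lemma op_deriv_eqI:
  assumes "has_op_derivative f D (at z)"
  shows "op_deriv f z = D"
  unfolding op_deriv_def
proof (rule some_equality)
  show "has_op_derivative f D (at z)" by (rule assms)
next
  fix E assume "has_op_derivative f E (at z)"
  with assms have "(\<lambda>h. scaleC_op h E) = (\<lambda>h. scaleC_op h D)"
    unfolding has_op_derivative_def by (metis has_derivative_unique)
  from fun_cong[OF this, of 1] show "E = D" by (simp add: scaleC_op_simps)
qed

lemma op_power_series_op_deriv:
  assumes ps: "op_power_series_on r T f"
  shows "op_power_series_on r (op_diffs T) (op_deriv f)"
  unfolding op_power_series_on_def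
proof (intro conjI allI impI ballI)
  show "summable (\<lambda>n. norm (op_diffs T n) * s ^ n)" if "0 \<le> s \<and> s < r" for s
    by (rule summable_op_diffs[where r = r]) (use ps that in \<open>auto simp: op_power_series_on_def\<close>)
  show "(\<lambda>n. scaleC_op (z ^ n) (op_diffs T n)) sums op_deriv f z" if "z \<in> ball 0 r" for z
    using op_power_series_termdiff[OF ps that] by (simp add: op_deriv_eqI)
qed

text \<open>Each differentiation shifts the coefficients down by one place and multiplies them by their old index;
at the origin only the coefficient in place 0 is seen.\<close>

lemma op_power_series_higher_deriv:
  assumes "op_power_series_on r T f" "r > 0"
  shows "(op_deriv ^^ k) f 0 /\<^sub>R fact k = T k"
  using assms(1)
proof (induction k arbitrary: T f)
  case 0
  have "(\<lambda>n. scaleC_op (0 ^ n) (T n)) sums f 0"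
    using 0 \<open>r > 0\<close> by (simp add: op_power_series_on_def)
  moreover have "(\<lambda>n. scaleC_op (0 ^ n) (T n)) = (\<lambda>n. if n = 0 then T n else 0)"
    by (auto simp: fun_eq_iff zero_power scaleC_op.zero_left scaleC_op_simps)
  then have "(\<lambda>n. scaleC_op (0 ^ n) (T n)) sums T 0"
    by (simp only: sums_single)
  ultimately show ?case by (auto dest: sums_unique2)
next
  case (Suc k)
  have "(op_deriv ^^ k) (op_deriv f) 0 /\<^sub>R fact k = op_diffs T k"
    by (rule Suc.IH[OF op_power_series_op_deriv[OF Suc.prems]])
  then have "inverse (real (Suc k)) *\<^sub>R ((op_deriv ^^ Suc k) f 0 /\<^sub>R fact k)
      = inverse (real (Suc k)) *\<^sub>R op_diffs T k"
    by (simp add: funpow_swap1)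
  then show ?case
    by (simp add: op_diffs_def field_simps del: of_nat_Suc)
qed

section \<open>Taylor expansion of operator-valued holomorphic functions\<close>

text \<open>The Hermitian matrix coefficient \<open>\<langle>T x, y\<rangle>\<close>. The inner product of the type is only the real part \<open>u\<close> of the
Hermitian one, and the imaginary part is recovered as \<open>- u (\<i> T)\<close>. These functionals reduce statements
about operator-valued holomorphic functions to scalar ones.\<close>

definition coefficient_functional :: "l2 \<Rightarrow> l2 \<Rightarrow> (l2 \<Rightarrow>\<^sub>L l2) \<Rightarrow> complex" where
  "coefficient_functional x y T
     = Complex (inner (blinfun_apply T x) y) (- inner (blinfun_apply (scaleC_op \<i> T) x) y)"

lemma bounded_linear_coefficient_functional: "bounded_linear (coefficient_functional x y)"
proof -
  have u: "bounded_linear (\<lambda>T. inner (blinfun_apply T x) y)"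
    by (intro bounded_linear_compose[OF bounded_linear_inner_left] blinfun.bounded_linear_left)
  have v: "bounded_linear (\<lambda>T. inner (blinfun_apply (scaleC_op \<i> T) x) y)"
    by (rule bounded_linear_compose[OF u scaleC_op.bounded_linear_right])
  have "coefficient_functional x y T = of_real (inner (blinfun_apply T x) y)
      - of_real (inner (blinfun_apply (scaleC_op \<i> T) x) y) * \<i>" for T
    unfolding coefficient_functional_def by (auto simp: complex_eq_iff)
  moreover have "bounded_linear (\<lambda>T. of_real (inner (blinfun_apply T x) y)
      - of_real (inner (blinfun_apply (scaleC_op \<i> T) x) y) * \<i>)"
    by (intro bounded_linear_sub bounded_linear_compose[OF bounded_linear_of_real]
        bounded_linear_compose[OF bounded_linear_mult_left] u v)
  ultimately show ?thesis by presburger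
qed

text \<open>Writing \<open>c = Re c + \<i> Im c\<close> reduces complex homogeneity to the real linearity already known and to
\<open>\<i> (\<i> T) = - T\<close>.\<close>

lemma coefficient_functional_scaleC_op:
  "coefficient_functional x y (scaleC_op c T) = c * coefficient_functional x y T"
proof -
  have dec: "scaleC_op d S = Re d *\<^sub>R S + Im d *\<^sub>R scaleC_op \<i> S" for d S
    using scaleC_op_simps(1)[of "complex_of_real (Re d)" "complex_of_real (Im d) * \<i>" S]
    by (simp only: scaleC_op_simps(3,5) mult.commute[of _ \<i>] complex_eq[symmetric])
      (simp only: scaleC_op.scaleR_right)
  have ii: "scaleC_op \<i> (scaleC_op \<i> S) = - S" for S
    by (simp flip: scaleC_op_simps(3)) (simp add: scaleC_op.minus_left scaleC_op_simps)
  show ?thesis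
    unfolding coefficient_functional_def
    by (subst (1 2) dec[of c])
      (simp add: complex_eq_iff scaleC_op.add_right scaleC_op.scaleR_right ii
        blinfun.add_left blinfun.scaleR_left blinfun.minus_left blinfun.diff_left
        inner_add_left inner_diff_left algebra_simps)
qed

lemma coefficient_functional_eqD:
  assumes "\<And>x y. coefficient_functional x y S = coefficient_functional x y T"
  shows "S = T"
proof (rule blinfun_eqI)
  fix x
  let ?y = "blinfun_apply S x - blinfun_apply T x"
  have "inner (blinfun_apply S x) ?y = inner (blinfun_apply T x) ?y"
    using assms[of x ?y] by (simp add: coefficient_functional_def)
  then have "inner ?y ?y = 0" by (simp only: inner_diff_left diff_self)
  then show "blinfun_apply S x = blinfun_apply T x" by simp
qed

lemma holomorphic_coefficient_functional:
  assumes "op_holomorphic_on f S" "open S"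
  shows "(\<lambda>z. coefficient_functional x y (f z)) holomorphic_on S"
proof (rule holomorphic_onI)
  fix z assume z: "z \<in> S"
  then obtain D where "has_op_derivative f D (at z within S)"
    using assms by (auto simp: op_holomorphic_on_def)
  then have "((\<lambda>z. coefficient_functional x y (f z)) has_derivative
      (\<lambda>h. coefficient_functional x y (scaleC_op h D))) (at z within S)"
    unfolding has_op_derivative_def
    by (rule bounded_linear.has_derivative[OF bounded_linear_coefficient_functional])
  then have "((\<lambda>z. coefficient_functional x y (f z)) has_field_derivative
      coefficient_functional x y D) (at z within S)"
    by (simp add: has_field_derivative_def coefficient_functional_scaleC_op mult.commute[of _ "coefficient_functional x y D"])
  then show "(\<lambda>z. coefficient_functional x y (f z)) field_differentiable at z within S"
    by (auto simp: field_differentiable_def)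
qed

lemma op_holomorphic_continuous_on:
  assumes "op_holomorphic_on f S"
  shows "continuous_on S f"
  using assms by (auto simp: op_holomorphic_on_def has_op_derivative_def
      continuous_on_eq_continuous_within intro: has_derivative_continuous)

text \<open>Cauchy's formula, written as an integral over the parameter interval: contour integrals are available
for scalar functions only, whereas integrals over an interval exist in every Banach space, and the
two are to be compared.\<close>

lemma higher_deriv_eq_circle_integral:
  assumes "\<phi> holomorphic_on cball 0 r" "0 < r"
  shows "integral {0..1} (\<lambda>t. inverse (circlepath 0 r t) ^ k * \<phi> (circlepath 0 r t))
           = (deriv ^^ k) \<phi> 0 / fact k"
proof -
  have "((\<lambda>u. \<phi> u / (u - 0) ^ Suc k) has_contour_integral 2 * pi * \<i> / fact k * (deriv ^^ k) \<phi> 0)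
      (circlepath 0 r)"
    using assms by (intro Cauchy_has_contour_integral_higher_derivative_circlepath
        holomorphic_on_imp_continuous_on) (auto intro: holomorphic_on_subset)
  then have "((\<lambda>t. \<phi> (circlepath 0 r t) / circlepath 0 r t ^ Suc k
      * vector_derivative (circlepath 0 r) (at t within {0..1}))
      has_integral 2 * pi * \<i> / fact k * (deriv ^^ k) \<phi> 0) {0..1}"
    by (simp add: has_contour_integral_def)
  then have "((\<lambda>t. 2 * pi * \<i> * (inverse (circlepath 0 r t) ^ k * \<phi> (circlepath 0 r t)))
      has_integral 2 * pi * \<i> / fact k * (deriv ^^ k) \<phi> 0) {0..1}"
  proof (rule has_integral_eq[rotated])
    fix t :: real assume t: "t \<in> {0..1}"
    have "circlepath 0 r t \<noteq> 0" using \<open>0 < r\<close> by (simp add: circlepath)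
    moreover have "vector_derivative (circlepath 0 r) (at t within {0..1})
        = 2 * pi * \<i> * circlepath 0 r t"
      using t by (subst vector_derivative_circlepath01) (auto simp: circlepath)
    ultimately show "\<phi> (circlepath 0 r t) / circlepath 0 r t ^ Suc k
        * vector_derivative (circlepath 0 r) (at t within {0..1})
      = 2 * pi * \<i> * (inverse (circlepath 0 r t) ^ k * \<phi> (circlepath 0 r t))"
      by (simp add: field_simps)
  qed
  from has_integral_mult_right[OF this, of "inverse (2 * pi * \<i>)"]
  have "((\<lambda>t. inverse (circlepath 0 r t) ^ k * \<phi> (circlepath 0 r t))
      has_integral (deriv ^^ k) \<phi> 0 / fact k) {0..1}"
    by (simp add: field_simps)
  then show ?thesis by (rule integral_unique)
qed

text \<open>The Cauchy integrals over the circle of radius \<open>r\<close> exist as integrals of continuous functions with values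
in the Banach space of operators. Matrix coefficients commute with the integral, so they turn these
integrals into the Taylor coefficients of scalar holomorphic functions. Hence the power series built
from them has the same matrix coefficients as \<open>f\<close>, and it is equal to \<open>f\<close>. In particular \<open>f\<close> has
derivatives of all orders, which the definition of an operator-valued holomorphic function does not
provide.\<close>

lemma op_holomorphic_imp_power_series:
  assumes hol: "op_holomorphic_on f (ball 0 R)" and r: "0 < r" "r < R"
  shows "op_power_series_on r (\<lambda>k. (op_deriv ^^ k) f 0 /\<^sub>R fact k) f"
proof -
  define \<gamma> where "\<gamma> = circlepath 0 r"
  have \<gamma>n: "norm (\<gamma> t) = r" for t using r by (simp add: \<gamma>_def circlepath norm_mult)
  have \<gamma>0: "\<gamma> t \<noteq> 0" for t using \<gamma>n[of t] r by auto
  have c\<gamma>: "continuous_on {0..1} \<gamma>"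
    unfolding \<gamma>_def using path_circlepath by (simp add: path_def)
  define F where "F k t = scaleC_op (inverse (\<gamma> t) ^ k) (f (\<gamma> t))" for k t
  define T where "T k = integral {0..1} (F k)" for k
  have cf: "continuous_on {0..1} (\<lambda>t. f (\<gamma> t))"
    by (rule continuous_on_compose2[OF op_holomorphic_continuous_on[OF hol] c\<gamma>])
      (use r \<gamma>n in auto)
  have cF: "continuous_on {0..1} (F k)" for k
    unfolding F_def by (intro scaleC_op.continuous_on continuous_intros cf c\<gamma>) (simp add: \<gamma>0)
  obtain B where B: "\<And>t. t \<in> {0..1} \<Longrightarrow> norm (f (\<gamma> t)) \<le> B"
    using compact_imp_bounded[OF compact_continuous_image[OF cf compact_Icc]]
    unfolding bounded_iff by blast
  have normT: "norm (T k) \<le> B / r ^ k" for k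
  proof -
    have "norm (T k) \<le> B / r ^ k * (1 - 0)"
      unfolding T_def
    proof (rule integral_bound)
      show "norm (F k t) \<le> B / r ^ k" if "t \<in> {0..1}" for t
        using B[OF that] r by (simp add: F_def norm_scaleC_op norm_power norm_divide \<gamma>n field_simps)
    qed (use cF in auto)
    then show ?thesis by simp
  qed
  have coeff: "coefficient_functional x y (T k)
      = (deriv ^^ k) (\<lambda>z. coefficient_functional x y (f z)) 0 / fact k" for x y k
  proof -
    have "coefficient_functional x y (T k) = integral {0..1} (coefficient_functional x y \<circ> F k)"
      unfolding T_def
      by (intro integral_linear[symmetric] integrable_continuous_real cF
          bounded_linear_coefficient_functional)
    also have "coefficient_functional x y \<circ> F k
        = (\<lambda>t. inverse (\<gamma> t) ^ k * coefficient_functional x y (f (\<gamma> t)))"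
      by (simp add: F_def o_def coefficient_functional_scaleC_op)
    also have "integral {0..1} \<dots> = (deriv ^^ k) (\<lambda>z. coefficient_functional x y (f z)) 0 / fact k"
      unfolding \<gamma>_def
      by (rule higher_deriv_eq_circle_integral
          [OF holomorphic_on_subset[OF holomorphic_coefficient_functional[OF hol open_ball]]])
        (use r in auto)
    finally show ?thesis .
  qed
  have sm: "summable (\<lambda>n. norm (T n) * s ^ n)" if s: "0 \<le> s" "s < r" for s
  proof (rule summable_comparison_test_ev[OF always_eventually])
    show "summable (\<lambda>n. B * (s / r) ^ n)"
      using s by (intro summable_mult summable_geometric) auto
    have "norm (T n) * s ^ n \<le> B / r ^ n * s ^ n" for n
      using normT s by (intro mult_right_mono) auto
    then show "\<forall>n. norm (norm (T n) * s ^ n) \<le> B * (s / r) ^ n"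
      using s by (simp add: power_divide)
  qed
  have "op_power_series_on r T f"
    unfolding op_power_series_on_def
  proof (intro conjI allI impI ballI)
    fix z :: complex assume z: "z \<in> ball 0 r"
    have "summable (\<lambda>n. scaleC_op (z ^ n) (T n))"
      by (rule summable_norm_cancel)
        (use sm[of "norm z"] z in \<open>simp add: norm_scaleC_op norm_power mult.commute\<close>)
    then have sums: "(\<lambda>n. scaleC_op (z ^ n) (T n)) sums (\<Sum>n. scaleC_op (z ^ n) (T n))"
      by (rule summable_sums)
    moreover have "(\<Sum>n. scaleC_op (z ^ n) (T n)) = f z"
    proof (rule coefficient_functional_eqD)
      fix x y
      have "(\<lambda>n. coefficient_functional x y (scaleC_op (z ^ n) (T n)))
          sums coefficient_functional x y (\<Sum>n. scaleC_op (z ^ n) (T n))"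
        by (rule bounded_linear.sums[OF bounded_linear_coefficient_functional sums])
      moreover have "(\<lambda>n. (deriv ^^ n) (\<lambda>z. coefficient_functional x y (f z)) 0 / fact n * (z - 0) ^ n)
          sums coefficient_functional x y (f z)"
        by (rule holomorphic_power_series[OF holomorphic_coefficient_functional[OF hol open_ball]])
          (use z r in auto)
      ultimately show "coefficient_functional x y (\<Sum>n. scaleC_op (z ^ n) (T n))
          = coefficient_functional x y (f z)"
        by (intro sums_unique2) (auto simp: coefficient_functional_scaleC_op coeff mult.commute)
    qed
    ultimately show "(\<lambda>n. scaleC_op (z ^ n) (T n)) sums f z" by simp
  qed (use sm in auto)
  moreover from op_power_series_higher_deriv[OF this r(1)]
  have "(\<lambda>k. (op_deriv ^^ k) f 0 /\<^sub>R fact k) = T" by auto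
  ultimately show ?thesis by simp
qed

section \<open>Taylor expansion of bounded functions on the bidisc\<close>

text \<open>The polynomial \<open>z1^k * P (z2 / z1)\<close>, written without division; the terms of \<open>P\<close> of degree above \<open>k\<close> are
dropped.\<close>

definition homogenization :: "nat \<Rightarrow> complex poly \<Rightarrow> complex \<times> complex \<Rightarrow> complex" where
  "homogenization k P z = (\<Sum>j\<le>k. coeff P j * fst z ^ (k - j) * snd z ^ j)"

text \<open>This is where the bound on the degree enters: it makes the coefficients of \<open>w^k\<close> along the lines
\<open>w \<mapsto> (w, w * \<zeta>)\<close> and the homogeneous polynomials of degree \<open>k\<close> in two variables the same objects.\<close>

lemma homogenization_line:
  assumes "degree P \<le> k"
  shows "homogenization k P (w, w * \<zeta>) = w ^ k * poly P \<zeta>"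
proof -
  have "poly P \<zeta> = (\<Sum>j\<le>k. coeff P j * \<zeta> ^ j)"
    by (subst poly_as_sum_of_monoms'[OF assms, symmetric]) (simp add: poly_sum poly_monom)
  moreover have "w ^ (k - j) * (w * \<zeta>) ^ j = w ^ k * \<zeta> ^ j" if "j \<le> k" for j
    using that by (simp add: power_mult_distrib flip: power_add mult.assoc)
  ultimately show ?thesis
    by (auto simp: homogenization_def sum_distrib_left mult_ac intro!: sum.cong)
qed

lemma norm_homogenization_le:
  assumes "\<And>j. cmod (coeff P j) \<le> B" "cmod (fst z) \<le> s" "cmod (snd z) \<le> s"
  shows "cmod (homogenization k P z) \<le> B * real (Suc k) * s ^ k"
proof -
  have B: "0 \<le> B" using assms(1)[of 0] norm_ge_zero order_trans by blast
  have s: "0 \<le> s" using assms(2) norm_ge_zero order_trans by blast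
  have "cmod (homogenization k P z) \<le> (\<Sum>j\<le>k. B * s ^ k)"
    unfolding homogenization_def
  proof (rule sum_norm_le)
    fix j assume j: "j \<in> {..k}"
    have "cmod (coeff P j * fst z ^ (k - j) * snd z ^ j) \<le> B * s ^ (k - j) * s ^ j"
      unfolding norm_mult norm_power using assms B s
      by (intro mult_mono power_mono mult_nonneg_nonneg) auto
    then show "cmod (coeff P j * fst z ^ (k - j) * snd z ^ j) \<le> B * s ^ k"
      using j by (simp add: mult.assoc flip: power_add)
  qed
  then show ?thesis by (simp add: mult_ac)
qed

text \<open>Cauchy's inequality on the circles of radius \<open>r < 1\<close>, in the limit \<open>r \<rightarrow> 1\<close>; the function need not extend to
the boundary.\<close>

lemma norm_higher_deriv_le_ball:
  assumes hol: "\<phi> holomorphic_on ball 0 1" and bd: "\<And>z. z \<in> ball 0 1 \<Longrightarrow> cmod (\<phi> z) \<le> B"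
  shows "cmod ((deriv ^^ n) \<phi> 0) \<le> fact n * B"
proof -
  have le: "cmod ((deriv ^^ n) \<phi> 0) * r ^ n \<le> fact n * B" if r: "0 < r" "r < 1" for r :: real
  proof -
    have "cmod ((deriv ^^ n) \<phi> 0) \<le> fact n * B / r ^ n"
      using r bd by (intro Cauchy_inequality continuous_on_subset[OF holomorphic_on_imp_continuous_on[OF hol]]
          holomorphic_on_subset[OF hol]) auto
    then show ?thesis using r by (simp add: field_simps)
  qed
  have "((\<lambda>r. cmod ((deriv ^^ n) \<phi> 0) * r ^ n) \<longlongrightarrow> cmod ((deriv ^^ n) \<phi> 0) * 1 ^ n) (at_left (1::real))"
    by (intro tendsto_intros)
  then have "cmod ((deriv ^^ n) \<phi> 0) * 1 ^ n \<le> fact n * B"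
  proof (rule tendsto_upperbound)
    show "\<forall>\<^sub>F r in at_left (1::real). cmod ((deriv ^^ n) \<phi> 0) * r ^ n \<le> fact n * B"
      using eventually_at_left_real[of 0 1] by (auto elim!: eventually_mono simp: le)
  qed simp
  then show ?thesis by simp
qed

text \<open>The bound depends on the coefficients through \<open>B\<close> only, hence it is uniform over a family of power
series.\<close>

lemma power_series_remainder_le:
  fixes a :: "nat \<Rightarrow> complex"
  assumes sums: "(\<lambda>n. a n * t ^ n) sums s" and a: "\<And>n. cmod (a n) \<le> B" and t: "cmod t \<le> 1 / 2"
  shows "cmod (s - (\<Sum>i<m. a i * t ^ i)) \<le> 2 * B * cmod t ^ m"
proof -
  have B: "0 \<le> B" using a[of 0] norm_ge_zero order_trans by blast
  have bd: "cmod (a (i + m) * t ^ (i + m)) \<le> B * cmod t ^ m * (1 / 2) ^ i" for i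
  proof -
    have "cmod (a (i + m)) * (cmod t ^ i * cmod t ^ m) \<le> B * ((1 / 2) ^ i * cmod t ^ m)"
      using a B t by (intro mult_mono power_mono) auto
    then show ?thesis by (simp add: norm_mult norm_power power_add mult_ac)
  qed
  have g: "summable (\<lambda>i. B * cmod t ^ m * (1 / 2) ^ i)"
    by (intro summable_mult summable_geometric) auto
  have "(\<lambda>i. a (i + m) * t ^ (i + m)) sums (s - (\<Sum>i<m. a i * t ^ i))"
    using sums by (rule sums_split_initial_segment)
  then have "s - (\<Sum>i<m. a i * t ^ i) = (\<Sum>i. a (i + m) * t ^ (i + m))"
    by (simp add: sums_iff)
  also have "cmod \<dots> \<le> (\<Sum>i. B * cmod t ^ m * (1 / 2) ^ i)"
    by (rule norm_suminf_le[OF bd g])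
  also have "\<dots> = 2 * B * cmod t ^ m"
    by (subst suminf_mult) (auto simp: suminf_geometric summable_geometric)
  finally show ?thesis .
qed

text \<open>Boundedness together with holomorphy in each variable separately suffices for the double Taylor
expansion at the origin.\<close>

locale bounded_separately_holomorphic =
  fixes q :: "complex \<times> complex \<Rightarrow> complex" and B :: real
  assumes hol_snd: "\<And>z1. z1 \<in> ball 0 1 \<Longrightarrow> (\<lambda>z2. q (z1, z2)) holomorphic_on ball 0 1"
    and hol_fst: "\<And>z2. z2 \<in> ball 0 1 \<Longrightarrow> (\<lambda>z1. q (z1, z2)) holomorphic_on ball 0 1"
    and bounded: "\<And>z1 z2. z1 \<in> ball 0 1 \<Longrightarrow> z2 \<in> ball 0 1 \<Longrightarrow> cmod (q (z1, z2)) \<le> B"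
begin

definition slice_deriv :: "nat \<Rightarrow> complex \<Rightarrow> complex" where
  "slice_deriv j z1 = (deriv ^^ j) (\<lambda>z2. q (z1, z2)) 0"

definition taylor_coeff :: "nat \<Rightarrow> nat \<Rightarrow> complex" where
  "taylor_coeff i j = partial_deriv (i, j) q (0, 0) / (fact i * fact j)"

definition homogeneous_part :: "nat \<Rightarrow> complex poly" where
  "homogeneous_part k = (\<Sum>j\<le>k. monom (taylor_coeff (k - j) j) j)"

lemma norm_slice_deriv_le: "z1 \<in> ball 0 1 \<Longrightarrow> cmod (slice_deriv j z1) \<le> fact j * B"
  unfolding slice_deriv_def by (intro norm_higher_deriv_le_ball hol_snd bounded)

lemma slice_deriv_sums:
  assumes "z1 \<in> ball 0 1" "z2 \<in> ball 0 1"
  shows "(\<lambda>j. slice_deriv j z1 / fact j * z2 ^ j) sums q (z1, z2)"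
  using holomorphic_power_series[OF hol_snd[OF assms(1)] assms(2)] by (simp add: slice_deriv_def)

text \<open>Given that the coefficients of lower order are holomorphic in \<open>z1\<close>, the \<open>j\<close>-th one is a uniform limit of
holomorphic functions: remove the lower terms from \<open>q (z1, t)\<close>, divide by \<open>t^j\<close>, and let \<open>t \<rightarrow> 0\<close>. The
Cauchy estimates bound the error by a multiple of \<open>\<bar>t\<bar>\<close>, uniformly in \<open>z1\<close>.\<close>

lemma slice_deriv_holomorphic: "slice_deriv j holomorphic_on ball 0 1"
proof (induction j rule: less_induct)
  case (less j)
  define t where "t n = complex_of_real (1 / real (n + 2))" for n
  have t0: "t n \<noteq> 0" for n by (simp add: t_def del: of_nat_add of_nat_Suc)
  have nt: "cmod (t n) = 1 / real (n + 2)" for n by (simp add: t_def norm_divide del: of_nat_add of_real_divide)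
  have t2: "cmod (t n) \<le> 1 / 2" for n unfolding nt by (simp add: field_simps)
  define F where "F n z1 = (q (z1, t n) - (\<Sum>i<j. slice_deriv i z1 / fact i * t n ^ i)) / t n ^ j" for n z1
  have "t n \<in> ball 0 1" for n using t2[of n] by simp
  then have hF: "F n holomorphic_on ball 0 1" for n
    unfolding F_def by (intro holomorphic_intros hol_fst less.IH) (auto simp: t0)
  have err: "cmod (F n z1 - slice_deriv j z1 / fact j) \<le> 2 * B * cmod (t n)" if z1: "z1 \<in> ball 0 1" for n z1
  proof -
    have "cmod (q (z1, t n) - (\<Sum>i<Suc j. slice_deriv i z1 / fact i * t n ^ i)) \<le> 2 * B * cmod (t n) ^ Suc j"
    proof (rule power_series_remainder_le[OF slice_deriv_sums[OF z1] _ t2])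
      show "cmod (slice_deriv i z1 / fact i) \<le> B" for i
        using norm_slice_deriv_le[OF z1, of i] by (simp add: norm_divide field_simps)
    qed (use t2[of n] in simp)
    moreover have "F n z1 - slice_deriv j z1 / fact j
        = (q (z1, t n) - (\<Sum>i<Suc j. slice_deriv i z1 / fact i * t n ^ i)) / t n ^ j"
      using t0[of n] by (simp add: F_def diff_divide_distrib add_divide_distrib)
    ultimately show ?thesis
      using t0[of n] by (simp add: norm_divide norm_power divide_le_eq mult_ac)
  qed
  have lim0: "(\<lambda>n. 2 * B * cmod (t n)) \<longlonglongrightarrow> 0"
    unfolding nt using tendsto_mult_right_zero[OF LIMSEQ_ignore_initial_segment[OF lim_inverse_n[where 'a=real], of 2]]
    by (simp add: inverse_eq_divide)
  have "uniform_limit (ball 0 1) F (\<lambda>z1. slice_deriv j z1 / fact j) sequentially"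
  proof (rule uniform_limitI)
    fix e :: real assume "e > 0"
    with lim0 have "\<forall>\<^sub>F n in sequentially. 2 * B * cmod (t n) < e" by (rule order_tendstoD)
    then show "\<forall>\<^sub>F n in sequentially. \<forall>z1\<in>ball 0 1. dist (F n z1) (slice_deriv j z1 / fact j) < e"
      by eventually_elim (auto simp: dist_norm intro: le_less_trans[OF err])
  qed
  then have ul: "\<exists>d>0. cball x d \<subseteq> ball 0 1
      \<and> uniform_limit (cball x d) F (\<lambda>z1. slice_deriv j z1 / fact j) sequentially"
    if "x \<in> ball 0 1" for x
    using that by (meson open_ball open_contains_cball uniform_limit_on_subset)
  have "(\<lambda>z1. slice_deriv j z1 / fact j) holomorphic_on ball 0 1"
    by (rule holomorphic_uniform_sequence[OF open_ball hF ul])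
  then have "(\<lambda>z1. fact j * (slice_deriv j z1 / fact j)) holomorphic_on ball 0 1"
    by (intro holomorphic_on_mult holomorphic_on_const)
  then show ?case by simp
qed

lemma taylor_coeff_eq: "taylor_coeff i j = (deriv ^^ i) (slice_deriv j) 0 / (fact i * fact j)"
  by (simp add: taylor_coeff_def partial_deriv_def slice_deriv_def[abs_def])

lemma norm_taylor_coeff_le: "cmod (taylor_coeff i j) \<le> B"
proof -
  have "cmod ((deriv ^^ i) (slice_deriv j) 0) \<le> fact i * (fact j * B)"
    by (intro norm_higher_deriv_le_ball slice_deriv_holomorphic norm_slice_deriv_le)
  then show ?thesis by (simp add: taylor_coeff_eq norm_divide norm_mult field_simps)
qed

lemma coeff_homogeneous_part:
  "coeff (homogeneous_part k) j = (if j \<le> k then taylor_coeff (k - j) j else 0)"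
  by (simp add: homogeneous_part_def coeff_sum sum.delta)

lemma degree_homogeneous_part: "degree (homogeneous_part k) \<le> k"
  by (rule degree_le) (simp add: coeff_homogeneous_part)

lemma norm_coeff_homogeneous_part_le: "cmod (coeff (homogeneous_part k) j) \<le> B"
  using norm_taylor_coeff_le[of "k - j" j] order_trans[OF norm_ge_zero norm_taylor_coeff_le]
  by (simp add: coeff_homogeneous_part)

text \<open>Expand first in the second variable and then each coefficient in the first. As the Taylor
coefficients are bounded, the double series is dominated by a product of two geometric series, so it
may be summed along the diagonals \<open>i + j = k\<close> instead.\<close>

lemma homogenization_sums:
  assumes z: "z1 \<in> ball 0 1" "z2 \<in> ball 0 1"
  shows "(\<lambda>k. homogenization k (homogeneous_part k) (z1, z2)) sums q (z1, z2)"
proof -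
  define h where "h = (\<lambda>(j, i). taylor_coeff i j * z1 ^ i * z2 ^ j)"
  have B: "0 \<le> B" using norm_ge_zero norm_taylor_coeff_le order_trans by blast
  have hb: "norm (h (j, i)) \<le> B * cmod z2 ^ j * cmod z1 ^ i" for j i
    using mult_right_mono[OF norm_taylor_coeff_le, of "cmod z1 ^ i * cmod z2 ^ j" i j]
    by (simp add: h_def norm_mult norm_power mult_ac)
  have geo: "((\<lambda>i. cmod z ^ i) has_sum (1 / (1 - cmod z))) UNIV" if "z \<in> ball 0 1" for z :: complex
    using that by (intro sums_nonneg_imp_has_sum geometric_sums) auto
  have "(\<lambda>(j, i). B * cmod z2 ^ j * cmod z1 ^ i) summable_on (UNIV \<times> UNIV)"
  proof (rule summable_on_SigmaI)
    show "((\<lambda>i. case (j, i) of (j, i) \<Rightarrow> B * cmod z2 ^ j * cmod z1 ^ i)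
        has_sum (B * cmod z2 ^ j * (1 / (1 - cmod z1)))) UNIV" for j :: nat
      unfolding prod.case by (intro has_sum_cmult_right geo z)
    show "(\<lambda>j. B * cmod z2 ^ j * (1 / (1 - cmod z1))) summable_on UNIV"
      using geo[OF z(2)] by (intro summable_on_cmult_left summable_on_cmult_right) (auto simp: summable_on_def)
  qed (use B in auto)
  then have "(\<lambda>x. norm (h x)) summable_on (UNIV \<times> UNIV)"
    by (rule summable_on_comparison_test) (use hb in auto)
  then have sh: "h summable_on (UNIV \<times> UNIV)" by (rule abs_summable_summable)
  have rows: "((\<lambda>i. h (j, i)) has_sum (slice_deriv j z1 / fact j * z2 ^ j)) UNIV" for j
  proof -
    have "(\<lambda>i. (deriv ^^ i) (slice_deriv j) 0 / fact i * (z1 - 0) ^ i) sums slice_deriv j z1"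
      by (rule holomorphic_power_series[OF slice_deriv_holomorphic z(1)])
    then have "(\<lambda>i. (deriv ^^ i) (slice_deriv j) 0 / fact i * (z1 - 0) ^ i * (z2 ^ j / fact j))
        sums (slice_deriv j z1 * (z2 ^ j / fact j))"
      by (rule sums_mult2)
    then have "(\<lambda>i. h (j, i)) sums (slice_deriv j z1 / fact j * z2 ^ j)"
      by (simp add: h_def taylor_coeff_eq mult_ac)
    moreover have "summable (\<lambda>i. norm (h (j, i)))"
    proof (rule summable_comparison_test_ev[OF always_eventually])
      show "summable (\<lambda>i. B * cmod z2 ^ j * cmod z1 ^ i)"
        using z by (intro summable_mult summable_geometric) auto
    qed (use hb in auto)
    ultimately show ?thesis by (intro norm_summable_imp_has_sum)
  qed
  have "((\<lambda>j. slice_deriv j z1 / fact j * z2 ^ j) has_sum infsum h (UNIV \<times> UNIV)) UNIV"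
    by (rule has_sum_SigmaD[OF has_sum_infsum[OF sh] rows])
  then have "infsum h (UNIV \<times> UNIV) = q (z1, z2)"
    using slice_deriv_sums[OF z] has_sum_imp_sums sums_unique2 by blast
  then have "(h has_sum q (z1, z2)) (UNIV \<times> UNIV)"
    using has_sum_infsum[OF sh] by simp
  then have "((\<lambda>(k, j). h (j, k - j)) has_sum q (z1, z2)) (SIGMA k:UNIV. {..k})"
    by (subst has_sum_reindex_bij_witness[where T = "UNIV \<times> UNIV" and h = h
          and i = "\<lambda>(j, i). (i + j, j)" and j = "\<lambda>(k, j). (j, k - j)"]) auto
  then have "((\<lambda>k. \<Sum>j\<le>k. h (j, k - j)) has_sum q (z1, z2)) UNIV"
    by (rule has_sum_SigmaD) (auto intro!: has_sum_finiteI)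
  then have "((\<lambda>k. homogenization k (homogeneous_part k) (z1, z2)) has_sum q (z1, z2)) UNIV"
    by (simp add: homogenization_def h_def coeff_homogeneous_part)
  then show ?thesis by (rule has_sum_imp_sums)
qed

end

section \<open>Coefficients of scalar power series\<close>

lemma power_series_eq_0:
  fixes a :: "nat \<Rightarrow> complex"
  assumes "0 < r" and sums: "\<And>w. norm w < r \<Longrightarrow> (\<lambda>n. a n * w ^ n) sums 0"
  shows "a n = 0"
proof (rule ccontr)
  assume an: "a n \<noteq> 0"
  have a0: "a 0 = 0" using sums[of 0] \<open>0 < r\<close> by simp
  then have "n > 0" using an by (cases n) auto
  have "\<And>x. norm (x - 0) < r \<Longrightarrow> (\<lambda>n. a n * (x - 0) ^ n) sums 0" using sums by simp
  then show False
  proof (rule powser_0_nonzero[where f = "\<lambda>_. 0" and \<xi> = 0 and a = a and m = n, OF \<open>0 < r\<close> _ refl an \<open>n > 0\<close>])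
    fix s :: real
    assume "0 < s" and "\<And>z::complex. z \<in> cball 0 s - {0} \<Longrightarrow> (0::complex) \<noteq> 0"
    from this(2)[of "of_real s"] this(1) show False by simp
  qed
qed

text \<open>The function \<open>\<psi> z = \<phi> z / z\<close> maps the disc to the closed disc by the Schwarz lemma, with \<open>\<psi> 0 = a 1\<close> and
\<open>\<psi>' 0 = a 2\<close>. Moving \<open>\<psi> 0\<close> to the origin by a Moebius transformation and applying the Schwarz lemma once
more bounds the derivative by 1, which is the claim.\<close>

lemma schwarz_pick_coefficients:
  fixes a :: "nat \<Rightarrow> complex"
  assumes sums: "\<And>z. z \<in> ball 0 1 \<Longrightarrow> (\<lambda>n. a n * z ^ n) sums \<phi> z" and a0: "a 0 = 0"
    and bd: "\<And>z. z \<in> ball 0 1 \<Longrightarrow> cmod (\<phi> z) \<le> 1"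
  shows "cmod (a 2) \<le> 1 - (cmod (a 1))\<^sup>2"
proof -
  have hol: "\<phi> holomorphic_on ball 0 1"
    by (rule power_series_holomorphic[where a = a]) (use sums in simp)
  have \<phi>0: "\<phi> 0 = 0" using sums[of 0] a0 by simp
  define \<psi> where "\<psi> z = (if z = 0 then a 1 else \<phi> z / z)" for z
  have \<psi>sums: "(\<lambda>n. a (Suc n) * z ^ n) sums \<psi> z" if z: "z \<in> ball 0 1" for z
  proof (cases "z = 0")
    case True
    then show ?thesis by (simp add: \<psi>_def)
  next
    case False
    have "(\<lambda>n. a (Suc n) * z ^ Suc n) sums \<phi> z"
      using sums[OF z] by (subst sums_Suc_iff) (simp add: a0)
    then have "(\<lambda>n. a (Suc n) * z ^ Suc n / z) sums (\<phi> z / z)" by (rule sums_divide)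
    then show ?thesis using False by (simp add: \<psi>_def)
  qed
  have \<psi>hol: "\<psi> holomorphic_on ball 0 1"
    by (rule power_series_holomorphic[where a = "\<lambda>n. a (Suc n)"]) (use \<psi>sums in simp)
  have d\<psi>: "(\<psi> has_field_derivative a 2) (at 0)"
  proof -
    have D: "(\<psi> has_field_derivative deriv \<psi> 0) (at 0)" (is "(_ has_field_derivative ?D) _")
      by (rule holomorphic_derivI[OF \<psi>hol]) auto
    have "(\<lambda>n. diffs (\<lambda>n. a (Suc n)) n * 0 ^ n) sums ?D"
      by (rule termdiffs_sums_strong[OF _ D, of 1]) (use \<psi>sums in auto)
    then have "a 2 = ?D" by (simp add: diffs_def numeral_2_eq_2)
    with D show ?thesis by simp
  qed
  \<comment> \<open>The Schwarz lemma asks for values in the open disc. One factor \<open>s < 1\<close> achieves this for \<open>\<phi>\<close> and a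
second one for \<open>\<psi>\<close>; both disappear in the limit \<open>s \<rightarrow> 1\<close>.\<close>
  have le: "cmod (a 2) * s\<^sup>2 \<le> 1 - (cmod (a 1) * s\<^sup>2)\<^sup>2" if s: "0 < s" "s < 1" for s :: real
  proof -
    have s\<phi>hol: "(\<lambda>z. s * \<phi> z) holomorphic_on ball 0 1"
      and s\<psi>hol: "(\<lambda>z. s\<^sup>2 * \<psi> z) holomorphic_on ball 0 1"
      by (intro holomorphic_on_mult holomorphic_on_const hol \<psi>hol)+
    have s\<phi>: "cmod (s * \<phi> w) < 1" if "cmod w < 1" for w
    proof -
      have "s * cmod (\<phi> w) \<le> s * 1" using bd[of w] s that by (intro mult_left_mono) auto
      then have "s * cmod (\<phi> w) < 1" using s by linarith
      then show ?thesis using s by (simp add: norm_mult)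
    qed
    have sz: "cmod (s * \<phi> z) \<le> cmod z" if z: "cmod z < 1" for z
    proof (rule Schwarz_Lemma(1)[OF _ _ _ z])
      show "cmod (s * \<phi> w) < 1" if "cmod w < 1" for w
        by (rule s\<phi>[OF that])
    qed (use s\<phi>hol \<phi>0 in auto)
    have a1: "cmod (s * a 1) \<le> 1"
    proof -
      have "cmod (deriv (\<lambda>z. s * \<phi> z) 0) \<le> 1"
      proof (rule Schwarz_Lemma(2)[where \<xi> = 0])
        show "cmod (s * \<phi> w) < 1" if "cmod w < 1" for w
          by (rule s\<phi>[OF that])
      qed (use s\<phi>hol \<phi>0 in auto)
      moreover have "(\<phi> has_field_derivative a 1) (at 0)"
      proof -
        have D: "(\<phi> has_field_derivative deriv \<phi> 0) (at 0)" (is "(_ has_field_derivative ?D) _")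
          by (rule holomorphic_derivI[OF hol]) auto
        have "(\<lambda>n. diffs a n * 0 ^ n) sums ?D"
          by (rule termdiffs_sums_strong[OF _ D, of 1]) (use sums in auto)
        then have "a 1 = ?D" by (simp add: diffs_def)
        with D show ?thesis by simp
      qed
      then have "deriv (\<lambda>z. s * \<phi> z) 0 = s * a 1"
        by (intro DERIV_imp_deriv DERIV_cmult)
      ultimately show ?thesis by simp
    qed
    have s\<psi>: "cmod (s\<^sup>2 * \<psi> z) < 1" if z: "cmod z < 1" for z
    proof -
      have "cmod (s * \<psi> z) \<le> 1"
        using a1 sz[OF z] by (auto simp: \<psi>_def norm_mult norm_divide divide_le_eq)
      then have "s * cmod (s * \<psi> z) < 1"
        using s mult_left_mono[of "cmod (s * \<psi> z)" 1 s] by linarith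
      then show ?thesis using s by (simp add: norm_mult power2_eq_square)
    qed
    define \<alpha> where "\<alpha> = s\<^sup>2 * a 1"
    have \<alpha>: "\<alpha> = s\<^sup>2 * \<psi> 0" "cmod \<alpha> < 1" using s\<psi>[of 0] by (auto simp: \<alpha>_def \<psi>_def)
    have real: "1 - cnj \<alpha> * \<alpha> = of_real (1 - (cmod \<alpha>)\<^sup>2)"
      by (metis complex_norm_square mult.commute of_real_1 of_real_diff)
    have pos: "1 - (cmod \<alpha>)\<^sup>2 > 0" using \<alpha>(2) by (simp add: abs_square_less_1)
    have nz: "1 - cnj \<alpha> * \<alpha> \<noteq> 0"
      unfolding real of_real_eq_0_iff using pos by simp
    define m where "m z = Moebius_function 0 \<alpha> (s\<^sup>2 * \<psi> z)" for z
    have "cmod (deriv m 0) \<le> 1"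
    proof (rule Schwarz_Lemma(2)[where \<xi> = 0])
      show "m 0 = 0" by (simp only: m_def \<alpha>(1)[symmetric] Moebius_function_eq_zero)
      show "cmod (m z) < 1" if "cmod z < 1" for z
        unfolding m_def by (rule Moebius_function_norm_lt_1[OF \<alpha>(2) s\<psi>[OF that]])
      have "Moebius_function 0 \<alpha> \<circ> (\<lambda>z. s\<^sup>2 * \<psi> z) holomorphic_on ball 0 1"
        by (rule holomorphic_on_compose_gen[OF _ Moebius_function_holomorphic[OF \<alpha>(2)]])
          (use s\<psi> s\<psi>hol in auto)
      then show "m holomorphic_on ball 0 1" unfolding m_def[abs_def] o_def .
    qed simp
    moreover have "(m has_field_derivative s\<^sup>2 * a 2 / (1 - cnj \<alpha> * \<alpha>)) (at 0)"
    proof -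
      have "((\<lambda>w. (w - \<alpha>) / (1 - cnj \<alpha> * w)) has_field_derivative
          ((1 - 0) * (1 - cnj \<alpha> * \<alpha>) - (\<alpha> - \<alpha>) * (0 - cnj \<alpha> * 1))
            / ((1 - cnj \<alpha> * \<alpha>) * (1 - cnj \<alpha> * \<alpha>))) (at \<alpha>)"
        by (intro DERIV_divide DERIV_diff DERIV_ident DERIV_const DERIV_cmult nz)
      also have "((1 - 0) * (1 - cnj \<alpha> * \<alpha>) - (\<alpha> - \<alpha>) * (0 - cnj \<alpha> * 1))
            / ((1 - cnj \<alpha> * \<alpha>) * (1 - cnj \<alpha> * \<alpha>)) = 1 / (1 - cnj \<alpha> * \<alpha>)"
        using nz by simp
      finally have "((\<lambda>w. (w - \<alpha>) / (1 - cnj \<alpha> * w)) has_field_derivative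
          1 / (1 - cnj \<alpha> * \<alpha>)) (at (s\<^sup>2 * \<psi> 0))"
        unfolding \<alpha>(1)[symmetric] .
      from DERIV_chain2[OF this DERIV_cmult[OF d\<psi>]]
      show ?thesis by (simp only: m_def[abs_def] Moebius_function_simple times_divide_eq_left mult_1_left)
    qed
    then have "deriv m 0 = s\<^sup>2 * a 2 / (1 - cnj \<alpha> * \<alpha>)" by (rule DERIV_imp_deriv)
    ultimately have "s\<^sup>2 * cmod (a 2) \<le> 1 - (cmod \<alpha>)\<^sup>2"
      using pos by (simp only: real norm_divide norm_mult norm_power norm_of_real) (simp add: divide_le_eq)
    then show ?thesis by (simp add: \<alpha>_def norm_mult norm_power mult.commute)
  qed
  have "cmod (a 2) * 1\<^sup>2 \<le> 1 - (cmod (a 1) * 1\<^sup>2)\<^sup>2"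
  proof (rule tendsto_le[OF trivial_limit_at_left_real])
    show "((\<lambda>s. 1 - (cmod (a 1) * s\<^sup>2)\<^sup>2) \<longlongrightarrow> 1 - (cmod (a 1) * 1\<^sup>2)\<^sup>2) (at_left (1::real))"
      "((\<lambda>s. cmod (a 2) * s\<^sup>2) \<longlongrightarrow> cmod (a 2) * 1\<^sup>2) (at_left (1::real))"
      by (intro tendsto_intros)+
    show "\<forall>\<^sub>F s in at_left (1::real). cmod (a 2) * s\<^sup>2 \<le> 1 - (cmod (a 1) * s\<^sup>2)\<^sup>2"
      using eventually_at_left_real[OF zero_less_one] by eventually_elim (simp add: le del: One_nat_def)
  qed
  then show ?thesis by simp
qed

text \<open>The radius of convergence does not change under termwise differentiation.\<close>

lemma summable_linear_weight:
  fixes c :: "nat \<Rightarrow> real"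
  assumes c: "\<And>s. 0 \<le> s \<Longrightarrow> s < 1 \<Longrightarrow> summable (\<lambda>n. c n * s ^ n)" and c0: "\<And>n. 0 \<le> c n"
    and s: "0 \<le> s" "s < 1"
  shows "summable (\<lambda>n. real (Suc n) * c n * s ^ n)"
proof -
  have "summable (\<lambda>n. c n * x ^ n)" if "norm x < 1" for x :: real
    by (rule summable_norm_cancel) (use c[of "norm x"] c0 that in \<open>simp add: abs_mult power_abs\<close>)
  then have "summable (\<lambda>n. diffs c n * s ^ n)"
    using s by (intro termdiff_converges[where K = 1]) auto
  then have "summable (\<lambda>n. s * (diffs c n * s ^ n))" by (rule summable_mult)
  then have "summable (\<lambda>n. real (Suc n) * c (Suc n) * s ^ Suc n)"
    by (simp add: diffs_def mult_ac)
  then have "summable (\<lambda>n. real n * c n * s ^ n)"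
    by (subst (asm) summable_Suc_iff)
  from summable_add[OF this c[OF s]] show ?thesis by (simp add: algebra_simps)
qed

section \<open>Power series of multiplication operators\<close>

lemma bounded_ops_closed:
  "T \<in> bounded_ops \<Longrightarrow> scaleC_op c T \<in> bounded_ops"
  "T \<in> bounded_ops \<Longrightarrow> r *\<^sub>R T \<in> bounded_ops"
  "(\<And>n. S n \<in> bounded_ops) \<Longrightarrow> S sums U \<Longrightarrow> U \<in> bounded_ops"
proof -
  show "T \<in> bounded_ops \<Longrightarrow> scaleC_op c T \<in> bounded_ops"
    by (simp add: bounded_ops_def mult.commute flip: scaleC_simps(3))
  then show "T \<in> bounded_ops \<Longrightarrow> r *\<^sub>R T \<in> bounded_ops"
    unfolding bounded_ops_def
    by (simp add: blinfun.scaleR_left bounded_linear_scaleC linear_scale bounded_linear.linear)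
  assume S: "\<And>n. S n \<in> bounded_ops" and U: "S sums U"
  have sums: "(\<lambda>n. blinfun_apply (S n) x) sums blinfun_apply U x" for x
    by (rule bounded_linear.sums[OF blinfun.bounded_linear_left U])
  show "U \<in> bounded_ops"
    unfolding bounded_ops_def
  proof (intro CollectI allI)
    fix c x
    have "(\<lambda>n. blinfun_apply (S n) (scaleC c x)) sums scaleC c (blinfun_apply U x)"
      using bounded_linear.sums[OF bounded_linear_scaleC sums[of x], of c] S
      by (simp add: bounded_ops_def)
    then show "blinfun_apply U (scaleC c x) = scaleC c (blinfun_apply U x)"
      using sums sums_unique2 by blast
  qed
qed

lemma op_power_series_imp_holomorphic:
  assumes ps: "op_power_series_on r T f" and T: "\<And>n. T n \<in> bounded_ops"
  shows "op_holomorphic_on f (ball 0 r)"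
  unfolding op_holomorphic_on_def
proof (intro conjI ballI)
  fix z :: complex assume z: "z \<in> ball 0 r"
  have "(\<lambda>n. scaleC_op (z ^ n) (T n)) sums f z"
    using ps z by (simp add: op_power_series_on_def)
  then show "f z \<in> bounded_ops"
    by (rule bounded_ops_closed(3)[rotated]) (intro bounded_ops_closed(1,2) T)
  have "(\<Sum>n. scaleC_op (z ^ n) (op_diffs T n)) \<in> bounded_ops"
    by (rule bounded_ops_closed(3)[OF _ op_power_series_termdiff(1)[OF ps z]])
      (unfold op_diffs_def, intro bounded_ops_closed(1,2) T)
  with op_power_series_termdiff(2)[OF ps z]
  show "\<exists>D\<in>bounded_ops. has_op_derivative f D (at z within ball 0 r)"
    by (auto simp: has_op_derivative_def intro: has_derivative_at_withinI)
qed

lemma partial_sum_mult_op: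
  "(\<Sum>k<n. scaleC_op (w ^ k) (mult_op (P k))) = mult_op (\<Sum>k<n. smult (w ^ k) (P k))"
  by (simp add: scaleC_op_mult_op mult_op_sum)

text \<open>On the circle, a partial sum of the scalar series differs from \<open>F w \<zeta>\<close> by at most a tail of
\<open>\<Sum>k. C * (k + 1) * \<bar>w\<bar>^k\<close>, which does not depend on \<open>\<zeta>\<close>. So the partial sums of the operator series are
multiplications by polynomials whose maximum on the circle is at most 1 plus this tail, and in the
limit the norm is at most 1.\<close>

lemma power_series_of_multiplications:
  fixes P :: "nat \<Rightarrow> complex poly"
  assumes P: "\<And>k \<zeta>. \<zeta> \<in> sphere 0 1 \<Longrightarrow> cmod (poly (P k) \<zeta>) \<le> C * real (Suc k)"
    and sums: "\<And>w \<zeta>. w \<in> ball 0 1 \<Longrightarrow> \<zeta> \<in> sphere 0 1 \<Longrightarrow> (\<lambda>k. w ^ k * poly (P k) \<zeta>) sums F w \<zeta>"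
    and F: "\<And>w \<zeta>. w \<in> ball 0 1 \<Longrightarrow> \<zeta> \<in> sphere 0 1 \<Longrightarrow> cmod (F w \<zeta>) \<le> 1"
  obtains f where "op_power_series_on 1 (\<lambda>k. mult_op (P k)) f"
    "\<And>w. w \<in> ball 0 1 \<Longrightarrow> norm (f w) \<le> 1"
proof -
  have C: "0 \<le> C" using order_trans[OF norm_ge_zero P[of 1 0]] by simp
  have nP: "norm (mult_op (P k)) \<le> C * real (Suc k)" for k
    by (rule norm_mult_op_le) (use P C in auto)
  have smC: "summable (\<lambda>k. C * real (Suc k) * s ^ k)" if "0 \<le> s" "s < 1" for s :: real
    using summable_mult[OF sums_summable[OF geometric_deriv_sums[of s]], of C] that
    by (simp add: mult.assoc)
  have sm: "summable (\<lambda>k. norm (mult_op (P k)) * s ^ k)" if s: "0 \<le> s" "s < 1" for s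
    by (rule summable_comparison_test_ev[OF always_eventually smC[OF s]])
      (use nP s in \<open>auto intro!: mult_right_mono\<close>)
  define f where "f w = (\<Sum>k. scaleC_op (w ^ k) (mult_op (P k)))" for w
  have fs: "(\<lambda>k. scaleC_op (w ^ k) (mult_op (P k))) sums f w" if w: "w \<in> ball 0 1" for w
    unfolding f_def
    by (rule summable_sums, rule summable_norm_cancel)
      (use sm[of "norm w"] w in \<open>simp add: norm_scaleC_op norm_power mult.commute\<close>)
  have "norm (f w) \<le> 1" if w: "w \<in> ball 0 1" for w
  proof -
    define b where "b k = C * real (Suc k) * norm w ^ k" for k
    have sb: "summable b" unfolding b_def using smC w by simp
    have le: "norm (\<Sum>k<n. scaleC_op (w ^ k) (mult_op (P k))) \<le> 1 + (\<Sum>k. b (k + n))" for n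
      unfolding partial_sum_mult_op
    proof (rule norm_mult_op_le)
      have "0 \<le> (\<Sum>k. b (k + n))"
        using C by (intro suminf_nonneg summable_ignore_initial_segment sb) (simp add: b_def)
      then show "0 \<le> 1 + (\<Sum>k. b (k + n))" by simp
      fix \<zeta> :: complex assume \<zeta>: "\<zeta> \<in> sphere 0 1"
      let ?t = "\<lambda>k. w ^ k * poly (P k) \<zeta>"
      have "(\<lambda>k. ?t (k + n)) sums (F w \<zeta> - (\<Sum>k<n. ?t k))"
        by (rule sums_split_initial_segment[OF sums[OF w \<zeta>]])
      moreover have "cmod (\<Sum>k. ?t (k + n)) \<le> (\<Sum>k. b (k + n))"
      proof (rule norm_suminf_le[OF _ summable_ignore_initial_segment[OF sb]])
        show "cmod (?t (k + n)) \<le> b (k + n)" for k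
          using mult_right_mono[OF P[OF \<zeta>, of "k + n"], of "norm w ^ (k + n)"]
          by (simp add: b_def norm_mult norm_power mult_ac)
      qed
      ultimately have "cmod (F w \<zeta> - (\<Sum>k<n. ?t k)) \<le> (\<Sum>k. b (k + n))"
        by (simp add: sums_iff)
      then have "cmod (\<Sum>k<n. ?t k) \<le> 1 + (\<Sum>k. b (k + n))"
        using F[OF w \<zeta>] norm_triangle_ineq2[of "\<Sum>k<n. ?t k" "F w \<zeta>"]
        by (simp add: norm_minus_commute)
      then show "cmod (poly (\<Sum>k<n. smult (w ^ k) (P k)) \<zeta>) \<le> 1 + (\<Sum>k. b (k + n))"
        by (simp add: poly_sum)
    qed
    have "(\<lambda>n. norm (\<Sum>k<n. scaleC_op (w ^ k) (mult_op (P k)))) \<longlonglongrightarrow> norm (f w)"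
      using fs[OF w] unfolding sums_def by (rule tendsto_norm)
    moreover have "(\<lambda>n. 1 + (\<Sum>k. b (k + n))) \<longlonglongrightarrow> 1 + 0"
      by (intro tendsto_intros suminf_exist_split2 sb)
    ultimately show ?thesis
      using le by (auto intro: LIMSEQ_le)
  qed
  moreover have "op_power_series_on 1 (\<lambda>k. mult_op (P k)) f"
    unfolding op_power_series_on_def using sm fs by auto
  ultimately show ?thesis using that by blast
qed

section \<open>Holomorphic functions of two variables given by homogeneous series\<close>

lemma sup_norm_le_1_iff: "sup_norm S g \<le> 1 \<longleftrightarrow> (\<forall>z\<in>S. norm (g z) \<le> 1)"
  by (simp add: sup_norm_def SUP_le_iff)

lemma open_bidisc: "open bidisc"
  by (simp add: bidisc_def open_Times)

lemma holomorphic2_imp_slices: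
  assumes q: "holomorphic2_on q bidisc"
  shows "z1 \<in> ball 0 1 \<Longrightarrow> (\<lambda>z2. q (z1, z2)) holomorphic_on ball 0 1"
    and "z2 \<in> ball 0 1 \<Longrightarrow> (\<lambda>z1. q (z1, z2)) holomorphic_on ball 0 1"
proof -
  have der: "\<exists>a b. (q has_derivative (\<lambda>(h1, h2). a * h1 + b * h2)) (at (w1, w2))"
    if "w1 \<in> ball 0 1" "w2 \<in> ball 0 1" for w1 w2
  proof -
    have w: "(w1, w2) \<in> bidisc" using that by (simp add: bidisc_def)
    then show ?thesis
      using q unfolding holomorphic2_on_def at_within_open[OF w open_bidisc, symmetric] by blast
  qed
  show "(\<lambda>z2. q (z1, z2)) holomorphic_on ball 0 1" if z1: "z1 \<in> ball 0 1"
  proof (rule holomorphic_onI)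
    fix z2 :: complex assume "z2 \<in> ball 0 1"
    then obtain a b where ab: "(q has_derivative (\<lambda>(h1, h2). a * h1 + b * h2)) (at (z1, z2))"
      using der z1 by blast
    have "((\<lambda>z2. (z1, z2)) has_derivative (\<lambda>h. (0, h))) (at z2 within ball 0 1)"
      by (intro has_derivative_Pair has_derivative_const has_derivative_ident)
    from has_derivative_compose[OF this ab]
    have "((\<lambda>z2. q (z1, z2)) has_derivative (*) b) (at z2 within ball 0 1)" by simp
    then show "(\<lambda>z2. q (z1, z2)) field_differentiable at z2 within ball 0 1"
      by (auto simp: field_differentiable_def has_field_derivative_def)
  qed
  show "(\<lambda>z1. q (z1, z2)) holomorphic_on ball 0 1" if z2: "z2 \<in> ball 0 1"
  proof (rule holomorphic_onI)
    fix z1 :: complex assume "z1 \<in> ball 0 1"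
    then obtain a b where ab: "(q has_derivative (\<lambda>(h1, h2). a * h1 + b * h2)) (at (z1, z2))"
      using der z2 by blast
    have "((\<lambda>z1. (z1, z2)) has_derivative (\<lambda>h. (h, 0))) (at z1 within ball 0 1)"
      by (intro has_derivative_Pair has_derivative_const has_derivative_ident)
    from has_derivative_compose[OF this ab]
    have "((\<lambda>z1. q (z1, z2)) has_derivative (*) a) (at z1 within ball 0 1)" by simp
    then show "(\<lambda>z1. q (z1, z2)) field_differentiable at z1 within ball 0 1"
      by (auto simp: field_differentiable_def has_field_derivative_def)
  qed
qed

text \<open>Apply the maximum modulus principle in one variable at a time, first with the other variable on the
circle of radius \<open>r\<close>. This reduces a bound on the bidisc to the tori \<open>\<bar>z1\<bar> = \<bar>z2\<bar>\<close>, which are exactly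
the points \<open>(w, w * \<zeta>)\<close> with \<open>\<bar>\<zeta>\<bar> = 1\<close>.\<close>

lemma polydisc_maximum_principle:
  assumes snd: "\<And>z1. z1 \<in> ball 0 1 \<Longrightarrow> (\<lambda>z2. g (z1, z2)) holomorphic_on ball 0 1"
    and fst: "\<And>z2. z2 \<in> ball 0 1 \<Longrightarrow> (\<lambda>z1. g (z1, z2)) holomorphic_on ball 0 1"
    and torus: "\<And>z1 z2. z1 \<in> ball 0 1 \<Longrightarrow> cmod z2 = cmod z1 \<Longrightarrow> z1 \<noteq> 0 \<Longrightarrow> cmod (g (z1, z2)) \<le> M"
    and z: "z1 \<in> ball 0 1" "z2 \<in> ball 0 1"
  shows "cmod (g (z1, z2)) \<le> M"
proof -
  obtain r where r: "max (cmod z1) (cmod z2) < r" "r < 1"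
    using z dense[of "max (cmod z1) (cmod z2)" 1] by auto
  then have r0: "0 < r" using norm_ge_zero[of z1] by linarith
  have mm: "cmod (\<phi> w) \<le> M" if hol: "\<phi> holomorphic_on ball 0 1" and w: "cmod w < r"
    and b: "\<And>u. cmod u = r \<Longrightarrow> cmod (\<phi> u) \<le> M" for \<phi> w
  proof (rule maximum_modulus_frontier[of \<phi> "cball 0 r"])
    show "\<phi> holomorphic_on interior (cball 0 r)" "continuous_on (closure (cball 0 r)) \<phi>"
      using r by (auto intro!: holomorphic_on_imp_continuous_on holomorphic_on_subset[OF hol])
  qed (use w b in \<open>auto simp: frontier_cball\<close>)
  have "cmod (g (u, z2)) \<le> M" if u: "cmod u = r" for u
  proof (rule mm[OF snd])
    have "u \<noteq> 0" using u r0 by auto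
    then show "cmod (g (u, v)) \<le> M" if "cmod v = r" for v
      using torus[of u v] that u r by simp
  qed (use u r in auto)
  then show ?thesis
    by (rule mm[OF fst[OF z(2)], rotated]) (use r in auto)
qed

text \<open>The sum of the derivatives is again of the form \<open>(h1, h2) \<mapsto> a * h1 + b * h2\<close>, so complex differentiability
survives the termwise differentiation.\<close>

lemma holomorphic2_series:
  fixes f :: "nat \<Rightarrow> complex \<times> complex \<Rightarrow> complex"
  assumes S: "convex S" "z0 \<in> S" "summable (\<lambda>n. f n z0)"
    and der: "\<And>n z. z \<in> S \<Longrightarrow> (f n has_derivative (\<lambda>(h1, h2). A n z * h1 + B n z * h2)) (at z within S)"
    and A: "\<And>n z. z \<in> S \<Longrightarrow> cmod (A n z) \<le> M n" and B: "\<And>n z. z \<in> S \<Longrightarrow> cmod (B n z) \<le> M n"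
    and M: "summable M"
  shows "\<exists>g. (\<forall>z\<in>S. (\<lambda>n. f n z) sums g z) \<and> holomorphic2_on g S"
proof -
  have "\<exists>g. \<forall>z\<in>S. (\<lambda>n. f n z) sums g z \<and>
      (g has_derivative (\<lambda>h. \<Sum>n. A n z * fst h + B n z * snd h)) (at z within S)"
  proof (rule has_derivative_series_M_test[where M = "\<lambda>n. 2 * M n" and f = f and ?x0.0 = z0])
    fix n z and h :: "complex \<times> complex" assume z: "z \<in> S"
    show "(f n has_derivative (\<lambda>h. A n z * fst h + B n z * snd h)) (at z within S)"
      using der[OF z] by (simp add: case_prod_unfold)
    have "cmod (fst h) \<le> norm h" "cmod (snd h) \<le> norm h"
      by (metis norm_fst_le norm_snd_le prod.collapse)+
    then have "cmod (A n z) * cmod (fst h) \<le> M n * norm h" "cmod (B n z) * cmod (snd h) \<le> M n * norm h"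
      using A[OF z, of n] B[OF z, of n] order_trans[OF norm_ge_zero A[OF z, of n]]
      by (auto intro: mult_mono)
    then have "cmod (A n z * fst h + B n z * snd h) \<le> M n * norm h + M n * norm h"
      by (intro norm_triangle_mono) (simp_all add: norm_mult)
    then show "norm (A n z * fst h + B n z * snd h) \<le> 2 * M n * norm h" by simp
  qed (intro S summable_mult M)+
  then obtain g where g: "\<And>z. z \<in> S \<Longrightarrow> (\<lambda>n. f n z) sums g z"
    and dg: "\<And>z. z \<in> S \<Longrightarrow> (g has_derivative (\<lambda>h. \<Sum>n. A n z * fst h + B n z * snd h)) (at z within S)"
    by blast
  have "holomorphic2_on g S"
    unfolding holomorphic2_on_def
  proof (intro ballI exI)
    fix z assume z: "z \<in> S"
    have sA: "summable (\<lambda>n. A n z)" and sB: "summable (\<lambda>n. B n z)"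
      by (rule summable_comparison_test_ev[OF always_eventually M], use A[OF z] B[OF z] in auto)+
    have "(\<Sum>n. A n z * fst h + B n z * snd h) = suminf (\<lambda>n. A n z) * fst h + suminf (\<lambda>n. B n z) * snd h" for h
      by (subst suminf_add[symmetric]) (simp_all add: sA sB summable_mult2 suminf_mult2)
    then show "(g has_derivative (\<lambda>(h1, h2). suminf (\<lambda>n. A n z) * h1 + suminf (\<lambda>n. B n z) * h2)) (at z within S)"
      using dg[OF z] by (simp add: case_prod_unfold)
  qed
  with g show ?thesis by blast
qed

lemma homogenization_has_derivative:
  "(homogenization k P has_derivative
     (\<lambda>(h1, h2). (\<Sum>j\<le>k. coeff P j * (of_nat (k - j) * fst z ^ (k - j - 1)) * snd z ^ j) * h1
             + (\<Sum>j\<le>k. coeff P j * fst z ^ (k - j) * (of_nat j * snd z ^ (j - 1))) * h2)) (at z within S)"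
proof -
  have t: "((\<lambda>z. c * fst z ^ m * snd z ^ j) has_derivative
      (\<lambda>h. c * (of_nat m * fst z ^ (m - 1)) * snd z ^ j * fst h
         + c * fst z ^ m * (of_nat j * snd z ^ (j - 1)) * snd h)) (at z within S)" for c :: complex and m j
    by (rule derivative_eq_intros refl | simp add: algebra_simps fun_eq_iff)+
  have "((\<lambda>z. \<Sum>j\<le>k. coeff P j * fst z ^ (k - j) * snd z ^ j) has_derivative
      (\<lambda>h. \<Sum>j\<le>k. coeff P j * (of_nat (k - j) * fst z ^ (k - j - 1)) * snd z ^ j * fst h
         + coeff P j * fst z ^ (k - j) * (of_nat j * snd z ^ (j - 1)) * snd h)) (at z within S)"
    by (rule has_derivative_sum) (rule t)
  then show ?thesis
    by (simp only: homogenization_def[abs_def] case_prod_unfold sum.distrib sum_distrib_right)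
qed

text \<open>On the polydisc of radius \<open>s\<close> the two partial derivatives of the \<open>k\<close>-th term are at most
\<open>(k + 1) * k * N k * s^(k - 1)\<close>; two linear weights do not affect the convergence for \<open>s < 1\<close>. The sums on
the different polydiscs are restrictions of one function.\<close>

lemma holomorphic2_on_homogenization_series:
  fixes P :: "nat \<Rightarrow> complex poly" and N :: "nat \<Rightarrow> real"
  assumes N: "\<And>k j. cmod (coeff (P k) j) \<le> N k"
    and sm: "\<And>s. 0 \<le> s \<Longrightarrow> s < 1 \<Longrightarrow> summable (\<lambda>k. N k * s ^ k)"
  obtains g where "holomorphic2_on g bidisc"
    "\<And>z. z \<in> bidisc \<Longrightarrow> (\<lambda>k. homogenization k (P k) z) sums g z"
proof -
  have N0: "0 \<le> N k" for k using N[of k 0] norm_ge_zero order_trans by blast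
  define Q where "Q s = (ball 0 s \<times> ball 0 s :: (complex \<times> complex) set)" for s
  have "\<exists>g. (\<forall>z\<in>Q s. (\<lambda>k. homogenization k (P k) z) sums g z) \<and> holomorphic2_on g (Q s)"
    if s: "0 < s" "s < 1" for s
  proof (rule holomorphic2_series[where M = "\<lambda>k. real (Suc k) * (real k * N k * s ^ (k - 1))" and ?z0.0 = 0])
    show "convex (Q s)" by (simp add: Q_def convex_Times)
    show "0 \<in> Q s" using s by (simp add: Q_def zero_prod_def)
    have "homogenization k (P k) 0 = (if k = 0 then coeff (P 0) 0 else 0)" for k
      by (cases k) (auto simp: homogenization_def power_0_left intro!: sum.neutral)
    then show "summable (\<lambda>k. homogenization k (P k) 0)" by simp
    have sm1: "summable (\<lambda>k. (real (Suc k) * N k) * t ^ k)" if "0 \<le> t" "t < 1" for t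
      by (rule summable_linear_weight[OF sm N0 that])
    have "summable (\<lambda>k. real (Suc k) * (real (Suc k) * N k) * s ^ k)"
      by (rule summable_linear_weight[OF sm1]) (use N0 s in auto)
    then have "summable (\<lambda>k. inverse s * (real (Suc k) * (real (Suc k) * N k) * s ^ k))"
      by (rule summable_mult)
    then show "summable (\<lambda>k. real (Suc k) * (real k * N k * s ^ (k - 1)))"
    proof (rule summable_comparison_test_ev[rotated, OF _ always_eventually], intro allI)
      fix k
      have "s ^ (k - 1) * real k = inverse s * s ^ k * real k" using s by (cases k) auto
      then have "real (Suc k) * (real k * N k * s ^ (k - 1)) = inverse s * (real (Suc k) * (real k * N k) * s ^ k)"
        by (simp add: mult_ac)
      also have "\<dots> \<le> inverse s * (real (Suc k) * (real (Suc k) * N k) * s ^ k)"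
        using s N0 by (intro mult_left_mono mult_right_mono) auto
      finally show "norm (real (Suc k) * (real k * N k * s ^ (k - 1)))
          \<le> inverse s * (real (Suc k) * (real (Suc k) * N k) * s ^ k)"
        using s N0 by simp
    qed
    show "(homogenization k (P k) has_derivative
     (\<lambda>(h1, h2). (\<Sum>j\<le>k. coeff (P k) j * (of_nat (k - j) * fst z ^ (k - j - 1)) * snd z ^ j) * h1
             + (\<Sum>j\<le>k. coeff (P k) j * fst z ^ (k - j) * (of_nat j * snd z ^ (j - 1))) * h2)) (at z within Q s)"
      for k z by (rule homogenization_has_derivative)
    fix k z assume "z \<in> Q s"
    then have z: "cmod (fst z) \<le> s" "cmod (snd z) \<le> s" by (auto simp: Q_def)
    have term_le: "cmod c * (real m * u ^ (m - 1)) * v ^ j \<le> real k * N k * s ^ (k - 1)"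
      if "cmod c \<le> N k" "m + j = k" "0 \<le> u" "u \<le> s" "0 \<le> v" "v \<le> s" for c m j u v
    \<comment> \<open>For \<open>m = 0\<close> the truncated exponent \<open>m - 1\<close> would spoil the power count, but the factor \<open>m\<close> vanishes.\<close>
    proof (cases m)
      case 0
      then show ?thesis using N0 s by simp
    next
      case (Suc m')
      have "cmod c * (real m * u ^ (m - 1)) * v ^ j \<le> N k * (real k * s ^ (m - 1)) * s ^ j"
        using that N0[of k] s by (intro mult_mono power_mono mult_nonneg_nonneg) auto
      also have "\<dots> = real k * N k * s ^ (m - 1 + j)" by (simp add: power_add mult_ac)
      also have "m - 1 + j = k - 1" using that Suc by simp
      finally show ?thesis .
    qed
    have "cmod (\<Sum>j\<le>k. coeff (P k) j * (of_nat (k - j) * fst z ^ (k - j - 1)) * snd z ^ j)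
        \<le> (\<Sum>j\<le>k. real k * N k * s ^ (k - 1))"
    proof (rule sum_norm_le)
      fix j assume "j \<in> {..k}"
      then show "cmod (coeff (P k) j * (of_nat (k - j) * fst z ^ (k - j - 1)) * snd z ^ j) \<le> real k * N k * s ^ (k - 1)"
        using term_le[OF N, of "k - j" j "cmod (fst z)" "cmod (snd z)" j] z
        by (simp only: norm_mult norm_power norm_of_nat) simp
    qed
    then show "cmod (\<Sum>j\<le>k. coeff (P k) j * (of_nat (k - j) * fst z ^ (k - j - 1)) * snd z ^ j)
        \<le> real (Suc k) * (real k * N k * s ^ (k - 1))" by simp
    have "cmod (\<Sum>j\<le>k. coeff (P k) j * fst z ^ (k - j) * (of_nat j * snd z ^ (j - 1)))
        \<le> (\<Sum>j\<le>k. real k * N k * s ^ (k - 1))"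
    proof (rule sum_norm_le)
      fix j assume "j \<in> {..k}"
      then show "cmod (coeff (P k) j * fst z ^ (k - j) * (of_nat j * snd z ^ (j - 1))) \<le> real k * N k * s ^ (k - 1)"
        using term_le[OF N, of j "k - j" "cmod (snd z)" "cmod (fst z)" j] z
        by (simp only: norm_mult norm_power norm_of_nat) (simp add: mult_ac)
    qed
    then show "cmod (\<Sum>j\<le>k. coeff (P k) j * fst z ^ (k - j) * (of_nat j * snd z ^ (j - 1)))
        \<le> real (Suc k) * (real k * N k * s ^ (k - 1))" by simp
  qed
  then obtain g where g: "\<And>s z. 0 < s \<Longrightarrow> s < 1 \<Longrightarrow> z \<in> Q s \<Longrightarrow> (\<lambda>k. homogenization k (P k) z) sums g s z"
    and hg: "\<And>s. 0 < s \<Longrightarrow> s < 1 \<Longrightarrow> holomorphic2_on (g s) (Q s)"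
    by metis
  define G where "G z = (\<Sum>k. homogenization k (P k) z)" for z
  have ex: "\<exists>s. 0 < s \<and> s < 1 \<and> z \<in> Q s" if z: "z \<in> bidisc" for z
  proof -
    obtain s where "max (cmod (fst z)) (cmod (snd z)) < s" "s < 1"
      using z dense[of "max (cmod (fst z)) (cmod (snd z))" 1] by (auto simp: bidisc_def)
    moreover from this have "0 < s" using norm_ge_zero[of "fst z"] by linarith
    ultimately show ?thesis by (intro exI[of _ s]) (auto simp: Q_def mem_Times_iff)
  qed
  have gG: "g s z = G z" if "0 < s" "s < 1" "z \<in> Q s" for s z
    using g[OF that] by (simp add: G_def sums_iff)
  have "(\<lambda>k. homogenization k (P k) z) sums G z" if "z \<in> bidisc" for z
    using ex[OF that] g gG by metis
  moreover have "holomorphic2_on G bidisc"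
    unfolding holomorphic2_on_def
  proof
    fix z assume z: "z \<in> bidisc"
    then obtain s where s: "0 < s" "s < 1" "z \<in> Q s" using ex by blast
    then obtain a b where "(g s has_derivative (\<lambda>(h1, h2). a * h1 + b * h2)) (at z within Q s)"
      using hg unfolding holomorphic2_on_def by blast
    then have "(G has_derivative (\<lambda>(h1, h2). a * h1 + b * h2)) (at z within Q s)"
      by (rule has_derivative_transform[OF s(3), rotated]) (use gG s in auto)
    moreover have "open (Q s)" by (simp add: Q_def open_Times)
    ultimately have "(G has_derivative (\<lambda>(h1, h2). a * h1 + b * h2)) (at z)"
      by (simp only: at_within_open[OF s(3)])
    then have "(G has_derivative (\<lambda>(h1, h2). a * h1 + b * h2)) (at z within bidisc)"
      by (rule has_derivative_at_withinI)
    then show "\<exists>a b. (G has_derivative (\<lambda>(h1, h2). a * h1 + b * h2)) (at z within bidisc)"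
      by (intro exI)
  qed
  ultimately show ?thesis by (intro that)
qed

lemma higher_deriv_poly_0:
  fixes P :: "complex poly"
  shows "(deriv ^^ j) (poly P) 0 = fact j * coeff P j"
proof (induction j arbitrary: P)
  case 0
  then show ?case by (simp add: poly_0_coeff_0)
next
  case (Suc j)
  have "deriv (poly P) = poly (pderiv P)"
    by (rule ext) (rule DERIV_imp_deriv[OF poly_DERIV])
  then have "(deriv ^^ Suc j) (poly P) 0 = fact j * coeff (pderiv P) j"
    by (simp add: funpow_swap1 Suc.IH)
  then show ?case by (simp add: coeff_pderiv algebra_simps)
qed

text \<open>Cauchy's inequality on the unit circle. For \<open>N = 0\<close> it says that a polynomial vanishing on the circle
is zero.\<close>

lemma norm_coeff_le_sup_circle:
  fixes P :: "complex poly"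
  assumes "\<And>z. z \<in> sphere 0 1 \<Longrightarrow> cmod (poly P z) \<le> N"
  shows "cmod (coeff P j) \<le> N"
proof -
  have "poly P holomorphic_on ball 0 1"
    by (rule holomorphic_onI) (unfold field_differentiable_def,
        blast intro: has_field_derivative_at_within poly_DERIV)
  moreover have "continuous_on (cball 0 1) (poly P)" by (rule continuous_on_poly) (rule continuous_on_id)
  ultimately have "cmod ((deriv ^^ j) (poly P) 0) \<le> fact j * N / 1 ^ j"
    by (rule Cauchy_inequality) (use assms in auto)
  then show ?thesis by (simp add: higher_deriv_poly_0 norm_mult)
qed

section \<open>The interpolation criterion\<close>

lemma bounded_coeffs:
  fixes P :: "complex poly"
  obtains B where "\<And>j. cmod (coeff P j) \<le> B"
  using poly_bounded_circle[of P] norm_coeff_le_sup_circle[of P] by metis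

lemma bounded_homogenization:
  obtains C where "\<And>z. z \<in> bidisc \<Longrightarrow> cmod (homogenization k P z) \<le> C"
proof -
  obtain B where B: "\<And>j. cmod (coeff P j) \<le> B" using bounded_coeffs[of P] by blast
  have "cmod (homogenization k P z) \<le> B * real (Suc k) * 1 ^ k" if "z \<in> bidisc" for z
    by (rule norm_homogenization_le) (use that B in \<open>auto simp: bidisc_def\<close>)
  then show ?thesis by (rule that)
qed

lemma bounded_by_homogenization_sum:
  assumes bd: "\<And>z. z \<in> bidisc \<Longrightarrow> cmod (homogenization 1 P1 z + homogenization 2 P2 z + q z) \<le> 1"
  obtains C where "\<And>z. z \<in> bidisc \<Longrightarrow> cmod (q z) \<le> C"
proof -
  obtain C1 where C1: "\<And>z. z \<in> bidisc \<Longrightarrow> cmod (homogenization 1 P1 z) \<le> C1"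
    using bounded_homogenization[of 1 P1] by blast
  obtain C2 where C2: "\<And>z. z \<in> bidisc \<Longrightarrow> cmod (homogenization 2 P2 z) \<le> C2"
    using bounded_homogenization[of 2 P2] by blast
  have "cmod (q z) \<le> 1 + C1 + C2" if z: "z \<in> bidisc" for z
  proof -
    have "q z = (homogenization 1 P1 z + homogenization 2 P2 z + q z)
        - homogenization 1 P1 z - homogenization 2 P2 z" by simp
    also have "cmod \<dots> \<le> 1 + C1 + C2"
      by (intro norm_triangle_le_diff[OF add_mono] norm_triangle_le_diff add_mono bd C1 C2 z)
    finally show ?thesis .
  qed
  then show ?thesis by (rule that)
qed

lemma line_in_bidisc: "w \<in> ball 0 1 \<Longrightarrow> \<zeta> \<in> sphere 0 1 \<Longrightarrow> (w, w * \<zeta>) \<in> bidisc"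
  by (simp add: bidisc_def norm_mult)

lemma bounded_separately_holomorphicI:
  assumes "holomorphic2_on q bidisc" "\<And>z. z \<in> bidisc \<Longrightarrow> cmod (q z) \<le> C"
  shows "bounded_separately_holomorphic q C"
  by (unfold_locales) (use assms holomorphic2_imp_slices[OF assms(1)] in \<open>auto simp: bidisc_def\<close>)

text \<open>Passing between the series of \<open>p + q\<close> and that of \<open>q\<close>, whose terms of order at most 2 vanish.\<close>

lemma sums_low_order_split:
  fixes F :: "nat \<Rightarrow> complex"
  assumes "F 0 = 0"
  shows "F sums S \<longleftrightarrow> (\<lambda>k. if k \<le> 2 then 0 else F k) sums (S - F 1 - F 2)"
proof -
  have "F sums S \<longleftrightarrow> (\<lambda>k. F (k + 3)) sums (S - (\<Sum>k<3. F k))"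
    by (rule sums_iff_shift'[symmetric])
  also have "\<dots> \<longleftrightarrow> (\<lambda>k. if k \<le> 2 then 0 else F k) sums (S - (\<Sum>k<3. F k))"
    using sums_iff_shift'[of "\<lambda>k. if k \<le> 2 then 0 else F k" 3 "S - (\<Sum>k<3. F k)"]
    by (simp add: eval_nat_numeral)
  also have "S - (\<Sum>k<3. F k) = S - F 1 - F 2"
    by (simp add: eval_nat_numeral assms)
  finally show ?thesis .
qed

text \<open>The homogeneous expansion of \<open>G = p + q\<close>, restricted to the line \<open>w \<mapsto> (w, w * \<zeta>)\<close>, is a power series in \<open>w\<close>
whose \<open>k\<close>-th coefficient is a polynomial in \<open>\<zeta>\<close> of degree at most \<open>k\<close>. For fixed \<open>\<zeta>\<close> it
vanishes at 0 and is bounded by 1, so the inequality between \<open>p1\<close> and \<open>p2\<close> is the Schwarz--Pick bound on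
its coefficients of order 1 and 2; for all \<open>\<zeta>\<close> together it is a power series of multiplication operators.\<close>

proposition interpolant_imp_operator_function:
  fixes p1 p2 :: "complex poly"
  assumes hol: "holomorphic2_on q bidisc"
    and jet: "\<And>k. fst k + snd k \<le> 2 \<Longrightarrow> partial_deriv k q (0, 0) = 0"
    and deg: "degree p1 \<le> 1" "degree p2 \<le> 2"
    and bd: "\<And>z. z \<in> bidisc \<Longrightarrow> cmod (homogenization 1 p1 z + homogenization 2 p2 z + q z) \<le> 1"
  shows "\<forall>z\<in>sphere 0 1. cmod (poly p2 z) \<le> 1 - (cmod (poly p1 z))\<^sup>2"
    and "\<exists>f P. op_holomorphic_on f (ball 0 1) \<and> (\<forall>w\<in>ball 0 1. norm (f w) \<le> 1)
           \<and> P 0 = 0 \<and> P 1 = p1 \<and> P 2 = p2 \<and> (\<forall>k. degree (P k) \<le> k)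
           \<and> (\<forall>k. (op_deriv ^^ k) f 0 /\<^sub>R fact k = mult_op (P k))"
proof -
  obtain C where C: "\<And>z. z \<in> bidisc \<Longrightarrow> cmod (q z) \<le> C"
    using bounded_by_homogenization_sum[OF bd] by blast
  interpret bounded_separately_holomorphic q C
    by (rule bounded_separately_holomorphicI[OF hol C])
  have hp0: "homogeneous_part k = 0" if "k \<le> 2" for k
    by (rule poly_eqI) (use that in \<open>simp add: coeff_homogeneous_part taylor_coeff_def jet\<close>)
  define P where "P k = (if k = 1 then p1 else if k = 2 then p2 else homogeneous_part k)" for k
  have P012: "P 0 = 0" "P 1 = p1" "P 2 = p2" by (simp_all add: P_def hp0)
  have degP: "degree (P k) \<le> k" for k
    using deg degree_homogeneous_part by (simp add: P_def)
  have split: "homogenization k (homogeneous_part k) z = (if k \<le> 2 then 0 else homogenization k (P k) z)" for k z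
  proof (cases "k \<le> 2")
    case True
    then show ?thesis by (simp add: hp0 homogenization_def)
  qed (simp add: P_def)
  define G where "G z = homogenization 1 p1 z + homogenization 2 p2 z + q z" for z
  have Gsums: "(\<lambda>k. homogenization k (P k) z) sums G z" if "z \<in> bidisc" for z
  proof -
    have "(\<lambda>k. homogenization k (homogeneous_part k) z) sums q z"
      using homogenization_sums[of "fst z" "snd z"] that by (auto simp: bidisc_def)
    then have "(\<lambda>k. if k \<le> 2 then 0 else homogenization k (P k) z)
        sums (G z - homogenization 1 (P 1) z - homogenization 2 (P 2) z)"
      unfolding split by (simp only: G_def P012 add_diff_cancel_left' diff_diff_eq)
    then show ?thesis
      by (subst sums_low_order_split) (auto simp: homogenization_def P012)
  qed
  have line: "(\<lambda>k. w ^ k * poly (P k) \<zeta>) sums G (w, w * \<zeta>)"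
    if "w \<in> ball 0 1" "\<zeta> \<in> sphere 0 1" for w \<zeta>
    using Gsums[OF line_in_bidisc[OF that]] by (simp add: homogenization_line degP)
  have Gle: "cmod (G (w, w * \<zeta>)) \<le> 1" if "w \<in> ball 0 1" "\<zeta> \<in> sphere 0 1" for w \<zeta>
    unfolding G_def by (rule bd[OF line_in_bidisc[OF that]])
  show "\<forall>z\<in>sphere 0 1. cmod (poly p2 z) \<le> 1 - (cmod (poly p1 z))\<^sup>2"
  proof
    fix \<zeta> :: complex assume \<zeta>: "\<zeta> \<in> sphere 0 1"
    have "cmod (poly (P 2) \<zeta>) \<le> 1 - (cmod (poly (P 1) \<zeta>))\<^sup>2"
    proof (rule schwarz_pick_coefficients[where \<phi> = "\<lambda>w. G (w, w * \<zeta>)"])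
      show "(\<lambda>k. poly (P k) \<zeta> * w ^ k) sums G (w, w * \<zeta>)" if "w \<in> ball 0 1" for w
        using line[OF that \<zeta>] by (simp add: mult.commute)
    qed (use Gle \<zeta> P012 in auto)
    then show "cmod (poly p2 \<zeta>) \<le> 1 - (cmod (poly p1 \<zeta>))\<^sup>2" by (simp only: P012)
  qed
  obtain B1 where B1: "\<And>j. cmod (coeff p1 j) \<le> B1" using bounded_coeffs[of p1] by blast
  obtain B2 where B2: "\<And>j. cmod (coeff p2 j) \<le> B2" using bounded_coeffs[of p2] by blast
  define B where "B = max C (max B1 B2)"
  have coeffB: "cmod (coeff (P k) j) \<le> B" for k j
    using B1[of j] B2[of j] norm_coeff_homogeneous_part_le[of k j] by (auto simp: P_def B_def)
  have polyB: "cmod (poly (P k) \<zeta>) \<le> B * real (Suc k)" if "\<zeta> \<in> sphere 0 1" for k \<zeta>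
    using norm_homogenization_le[OF coeffB, of "(1, 1 * \<zeta>)" 1 k k] that
    unfolding homogenization_line[OF degP] by simp
  obtain f where ps: "op_power_series_on 1 (\<lambda>k. mult_op (P k)) f"
    and f: "\<And>w. w \<in> ball 0 1 \<Longrightarrow> norm (f w) \<le> 1"
    using power_series_of_multiplications[OF polyB line Gle] by metis
  have "op_holomorphic_on f (ball 0 1)"
    by (rule op_power_series_imp_holomorphic[OF ps mult_op_in_bounded_ops])
  moreover have "(op_deriv ^^ k) f 0 /\<^sub>R fact k = mult_op (P k)" for k
    by (rule op_power_series_higher_deriv[OF ps zero_less_one])
  ultimately show "\<exists>f P. op_holomorphic_on f (ball 0 1) \<and> (\<forall>w\<in>ball 0 1. norm (f w) \<le> 1)
           \<and> P 0 = 0 \<and> P 1 = p1 \<and> P 2 = p2 \<and> (\<forall>k. degree (P k) \<le> k)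
           \<and> (\<forall>k. (op_deriv ^^ k) f 0 /\<^sub>R fact k = mult_op (P k))"
    using f P012 degP by blast
qed

text \<open>The Taylor polynomials of \<open>f w\<close> are multiplications by polynomials in \<open>\<zeta>\<close>, and the norm dominates their
values on the circle. In the limit the scalar series is bounded by the norm of \<open>f w\<close>, hence by 1, and
its homogenization \<open>G\<close> is bounded by 1 on the tori \<open>\<bar>z1\<bar> = \<bar>z2\<bar>\<close>, so on the bidisc. The required
function \<open>q\<close> consists of the terms of \<open>G\<close> of order at least 3.\<close>

proposition operator_function_imp_interpolant:
  assumes hol: "op_holomorphic_on f (ball 0 1)" and f: "\<And>w. w \<in> ball 0 1 \<Longrightarrow> norm (f w) \<le> 1"
    and P0: "P 0 = 0" and degP: "\<And>k. degree (P k) \<le> k"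
    and taylor: "\<And>k. (op_deriv ^^ k) f 0 /\<^sub>R fact k = mult_op (P k)"
  shows "\<exists>q. holomorphic2_on q bidisc \<and> (\<forall>k. fst k + snd k \<le> 2 \<longrightarrow> partial_deriv k q (0, 0) = 0)
     \<and> (\<forall>z\<in>bidisc. cmod (homogenization 1 (P 1) z + homogenization 2 (P 2) z + q z) \<le> 1)"
proof -
  have ps: "op_power_series_on r (\<lambda>k. mult_op (P k)) f" if "0 < r" "r < 1" for r
    using op_holomorphic_imp_power_series[OF hol that] by (simp only: taylor)
  have coeffN: "cmod (coeff (P k) j) \<le> norm (mult_op (P k))" for k j
    by (rule norm_coeff_le_sup_circle) (rule poly_le_norm_mult_op)
  have smN: "summable (\<lambda>k. norm (mult_op (P k)) * s ^ k)" if "0 \<le> s" "s < 1" for s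
    using ps[of "(s + 1) / 2"] that by (simp add: op_power_series_on_def)
  define P' where "P' k = (if k \<le> 2 then 0 else P k)" for k
  obtain G where G: "holomorphic2_on G bidisc"
    and Gsums: "\<And>z. z \<in> bidisc \<Longrightarrow> (\<lambda>k. homogenization k (P k) z) sums G z"
    using holomorphic2_on_homogenization_series[OF coeffN smN] by metis
  have coeffN': "cmod (coeff (P' k) j) \<le> norm (mult_op (P k))" for k j
    using coeffN by (simp add: P'_def)
  obtain q where q: "holomorphic2_on q bidisc"
    and qsums: "\<And>z. z \<in> bidisc \<Longrightarrow> (\<lambda>k. homogenization k (P' k) z) sums q z"
    using holomorphic2_on_homogenization_series[OF coeffN' smN] by metis
  have Gq: "G z = homogenization 1 (P 1) z + homogenization 2 (P 2) z + q z" if z: "z \<in> bidisc" for z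
  proof -
    have "(\<lambda>k. if k \<le> 2 then 0 else homogenization k (P k) z)
        sums (G z - homogenization 1 (P 1) z - homogenization 2 (P 2) z)"
      using Gsums[OF z] by (subst (asm) sums_low_order_split) (auto simp: homogenization_def P0)
    moreover have "(\<lambda>k. if k \<le> 2 then 0 else homogenization k (P k) z) = (\<lambda>k. homogenization k (P' k) z)"
      by (auto simp: P'_def homogenization_def fun_eq_iff)
    ultimately have "q z = G z - homogenization 1 (P 1) z - homogenization 2 (P 2) z"
      using qsums[OF z] sums_unique2 by metis
    then show ?thesis by simp
  qed
  have torus: "cmod (G (w, w * \<zeta>)) \<le> norm (f w)" if w: "w \<in> ball 0 1" and \<zeta>: "\<zeta> \<in> sphere 0 1" for w \<zeta>
  proof (rule LIMSEQ_le)
    obtain r where r: "norm w < r" "r < 1" using w dense[of "norm w" 1] by auto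
    then have "0 < r" using norm_ge_zero[of w] by linarith
    then have "(\<lambda>k. scaleC_op (w ^ k) (mult_op (P k))) sums f w"
      using ps[OF _ r(2)] r by (simp add: op_power_series_on_def)
    then show "(\<lambda>n. norm (\<Sum>k<n. scaleC_op (w ^ k) (mult_op (P k)))) \<longlonglongrightarrow> norm (f w)"
      unfolding sums_def by (rule tendsto_norm)
    have "(\<lambda>k. w ^ k * poly (P k) \<zeta>) sums G (w, w * \<zeta>)"
      using Gsums[OF line_in_bidisc[OF w \<zeta>]] by (simp add: homogenization_line degP)
    then show "(\<lambda>n. cmod (\<Sum>k<n. w ^ k * poly (P k) \<zeta>)) \<longlonglongrightarrow> cmod (G (w, w * \<zeta>))"
      unfolding sums_def by (rule tendsto_norm)
    have "cmod (\<Sum>k<n. w ^ k * poly (P k) \<zeta>) \<le> norm (\<Sum>k<n. scaleC_op (w ^ k) (mult_op (P k)))" for n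
      using poly_le_norm_mult_op[OF \<zeta>, of "\<Sum>k<n. smult (w ^ k) (P k)"]
      by (simp add: partial_sum_mult_op poly_sum)
    then show "\<exists>N. \<forall>n\<ge>N. cmod (\<Sum>k<n. w ^ k * poly (P k) \<zeta>)
        \<le> norm (\<Sum>k<n. scaleC_op (w ^ k) (mult_op (P k)))" by blast
  qed
  have torus1: "cmod (G (w, w * \<zeta>)) \<le> 1" if w: "w \<in> ball 0 1" and \<zeta>: "\<zeta> \<in> sphere 0 1" for w \<zeta>
    using torus[OF w \<zeta>] f[OF w] by (rule order_trans)
  have "cmod (G (z1, z2)) \<le> 1" if "z1 \<in> ball 0 1" "z2 \<in> ball 0 1" for z1 z2
  proof (rule polydisc_maximum_principle[OF holomorphic2_imp_slices[OF G] _ that])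
    fix w1 w2 :: complex assume w: "w1 \<in> ball 0 1" "cmod w2 = cmod w1" "w1 \<noteq> 0"
    then show "cmod (G (w1, w2)) \<le> 1"
      using torus1[of w1 "w2 / w1"] by (simp add: norm_divide)
  qed
  then have G1: "cmod (G z) \<le> 1" if "z \<in> bidisc" for z
    using that by (cases z) (auto simp: bidisc_def)
  have bd: "cmod (homogenization 1 (P 1) z + homogenization 2 (P 2) z + q z) \<le> 1" if "z \<in> bidisc" for z
    using G1[OF that] by (simp only: Gq[OF that])
  obtain C where C: "\<And>z. z \<in> bidisc \<Longrightarrow> cmod (q z) \<le> C"
    using bounded_by_homogenization_sum[OF bd] by blast
  interpret bounded_separately_holomorphic q C
    by (rule bounded_separately_holomorphicI[OF q C])
  \<comment> \<open>The iterated partial derivatives of \<open>q\<close> are read off from its Taylor expansion, which must agree with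
the defining series because both give the same power series on every line.\<close>
  have "homogeneous_part k = P' k" for k
  proof -
    have degP': "degree (P' k) \<le> k" for k using degP by (simp add: P'_def)
    have "poly (homogeneous_part k - P' k) \<zeta> = 0" if \<zeta>: "\<zeta> \<in> sphere 0 1" for \<zeta>
    proof (rule power_series_eq_0[of 1 "\<lambda>k. poly (homogeneous_part k - P' k) \<zeta>"])
      fix w :: complex assume "norm w < 1"
      then have z: "(w, w * \<zeta>) \<in> bidisc" using line_in_bidisc[OF _ \<zeta>] by simp
      then have "(\<lambda>k. homogenization k (homogeneous_part k) (w, w * \<zeta>)) sums q (w, w * \<zeta>)"
        by (intro homogenization_sums) (auto simp: bidisc_def)
      from sums_diff[OF this qsums[OF z]]
      show "(\<lambda>k. poly (homogeneous_part k - P' k) \<zeta> * w ^ k) sums 0"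
        unfolding homogenization_line[OF degP'] homogenization_line[OF degree_homogeneous_part]
        by (simp add: algebra_simps)
    qed simp
    then have "cmod (coeff (homogeneous_part k - P' k) j) \<le> 0" for j
      by (intro norm_coeff_le_sup_circle) simp
    then show ?thesis by (intro poly_eqI) simp
  qed
  then have "taylor_coeff i j = coeff (P' (i + j)) j" for i j
    using coeff_homogeneous_part[of "i + j" j] by simp
  then have "partial_deriv k q (0, 0) = 0" if "fst k + snd k \<le> 2" for k
    using that taylor_coeff_def[of "fst k" "snd k"] by (simp add: P'_def)
  with q bd show ?thesis by blast
qed

theorem theorem1p16:
  fixes a10 a01 a20 a11 a02 :: complex
    and p :: "complex \<times> complex \<Rightarrow> complex"
    and p1 p2 :: "complex poly"
  assumes p: "p = (\<lambda>(z1, z2). a10 * z1 + a01 * z2 + a20 * z1^2 + a11 * z1 * z2 + a02 * z2^2)"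
    and p1: "p1 = [:a10, a01:]"
    and p2: "p2 = [:a20, a11, a02:]"
  shows "(\<exists>q. holomorphic2_on q bidisc
            \<and> (\<forall>k. fst k + snd k \<le> 2 \<longrightarrow> partial_deriv k q (0, 0) = 0)
            \<and> sup_norm bidisc (\<lambda>z. p z + q z) \<le> 1)
     \<longleftrightarrow>
         (\<forall>z\<in>sphere 0 1. cmod (poly p2 z) \<le> 1 - (cmod (poly p1 z))^2)
       \<and> (\<exists>f :: complex \<Rightarrow> (l2 \<Rightarrow>\<^sub>L l2).
            op_holomorphic_on f (ball 0 1)
            \<and> sup_norm (ball 0 1) f \<le> 1
            \<and> (\<exists>P :: nat \<Rightarrow> complex poly.
                 P 0 = 0 \<and> P 1 = p1 \<and> P 2 = p2
                 \<and> (\<forall>k\<ge>3. degree (P k) \<le> k)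
                 \<and> (\<forall>k. (op_deriv ^^ k) f 0 /\<^sub>R fact k = mult_op (P k))))"
    (is "?L \<longleftrightarrow> ?R1 \<and> ?R2")
proof -
  have hom: "p z = homogenization 1 p1 z + homogenization 2 p2 z" for z
    by (cases z) (simp add: p p1 p2 homogenization_def eval_nat_numeral atMost_Suc algebra_simps)
  have deg: "degree p1 \<le> 1" "degree p2 \<le> 2" by (simp_all add: p1 p2)
  show ?thesis
  proof
    assume ?L
    then obtain q where hol: "holomorphic2_on q bidisc"
      and jet: "\<And>k. fst k + snd k \<le> 2 \<Longrightarrow> partial_deriv k q (0, 0) = 0"
      and bd: "\<And>z. z \<in> bidisc \<Longrightarrow> cmod (homogenization 1 p1 z + homogenization 2 p2 z + q z) \<le> 1"
      by (auto simp: sup_norm_le_1_iff hom)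
    obtain f P where f: "op_holomorphic_on f (ball 0 1)" "\<forall>w\<in>ball 0 1. norm (f w) \<le> 1"
      and P: "P 0 = 0" "P 1 = p1" "P 2 = p2" "\<forall>k. degree (P k) \<le> k"
        "\<forall>k. (op_deriv ^^ k) f 0 /\<^sub>R fact k = mult_op (P k)"
      using interpolant_imp_operator_function(2)[OF hol jet deg bd] by blast
    have ?R2
      by (intro exI[of _ f] conjI exI[of _ P]) (use f P in \<open>simp_all add: sup_norm_le_1_iff\<close>)
    with interpolant_imp_operator_function(1)[OF hol jet deg bd]
    show "?R1 \<and> ?R2" by blast
  next
    assume "?R1 \<and> ?R2"
    then obtain f P where f: "op_holomorphic_on f (ball 0 1)" "\<And>w. w \<in> ball 0 1 \<Longrightarrow> norm (f w) \<le> 1"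
      and P: "P 0 = 0" "P 1 = p1" "P 2 = p2" "\<And>k. k \<ge> 3 \<Longrightarrow> degree (P k) \<le> k"
      and taylor: "\<And>k. (op_deriv ^^ k) f 0 /\<^sub>R fact k = mult_op (P k)"
      by (auto simp only: sup_norm_le_1_iff)
    have degP: "degree (P k) \<le> k" for k
    proof -
      consider "k = 0" | "k = 1" | "k = 2" | "k \<ge> 3" by linarith
      then show ?thesis by cases (use P deg in auto)
    qed
    from operator_function_imp_interpolant[OF f P(1) degP taylor]
    show ?L by (simp only: P sup_norm_le_1_iff hom)
  qed
qed

end
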